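(* Consider the changepoint double array described in the context. Suppose (post-change separation) that $F_{P_0}$ and $H$ are continuous, $H(0)=0$, and $\sup_{t\in[0,1]}|H(t)-t|>0$. Suppose also (local KL support) that $H\ll U$ with $h:=dH/dU$ and $D_{\mathrm{KL}}(H\|U)=\int_0^1\log h\,dH\in(0,\infty)$, that $\phi:=\log h$ is bounded and Lipschitz, and that there are constants $a,c\ge0$ such that for every $r\ge1$ and all $z_1,\dots,z_r\in[0,1]$, $$\log\int_\Theta\prod_{i=1}^rf_\theta(z_i)\,d\Pi(\theta)\ge\sum_{i=1}^r\log h(z_i)-a\log r-c.$$ If $\mathcal B_{n,w}(b_n)\to\infty$ and $\mathcal B_{n,w}(b_n)=o(T_n)$, then for every $A>1/D_{\mathrm{KL}}(H\|U)$, $$\mathbb P_{P_0,T_n,P_1}\{\tau_{n,Z,w}(b_n)\le T_n+A\,\mathcal B_{n,w}(b_n)\}\to1,$$ and hence the same statement holds for $\tau_{n,S,w}(b_n)$. If moreover $\liminf_n q_{n,w}(b_n)>0$, then $$\mathbb P_{P_0,T_n,P_1}\{\tau_{n,Z,w}(b_n)>T_n+A\,\mathcal B_{n,w}(b_n)\mid\tau_{n,Z,w}(b_n)>T_n\}\to0,$$ and $$\liminf_{n\to\infty}\mathbb P_{P_0,T_n,P_1}\{T_n<\tau_{n,Z,w}(b_n)\le T_n+A\,\mathcal B_{n,w}(b_n)\}\ge\liminf_{n\to\infty}q_{n,w}(b_n);$$ the same statements hold for $\tau_{n,S,w}(b_n)$ as well.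
   Context: Data: $(T_n)_{n\ge1}$ is an increasing sequence of positive integers with $T_n\to\infty$; $P_0,P_1$ are probability measures on $\mathbb R$. For each $n$, the row $(X_{n,j})_{j\ge1}$ satisfies $X_{n,1},\dots,X_{n,T_n}\stackrel{iid}{\sim}P_0$, $X_{n,T_n+1},X_{n,T_n+2},\dots\stackrel{iid}{\sim}P_1$, the two blocks being independent; randomizers $\lambda_{n,j}\stackrel{iid}{\sim}U(0,1)$ are independent of the array. $\mathbb P_{P_0,T_n,P_1}$ is the law of row $n$ together with its randomizers. Conformal p-values: $p_{n,j}:=\frac1j\big(\sum_{i=1}^j\mathbf 1\{X_{n,i}<X_{n,j}\}+\lambda_{n,j}\sum_{i=1}^j\mathbf 1\{X_{n,i}=X_{n,j}\}\big)$. Detectors: $\mathcal F=\{f_\theta:\theta\in\Theta\}$ is a jointly measurable family of probability densities on $[0,1]$, $\Pi$ a probability measure on $\Theta$, $w=(w_k)_{k\ge1}$ a deterministic nonnegative weight sequence, $b_n>0$ deterministic thresholds. For $k\le t$, $M_{n,k,t}:=\int_\Theta\prod_{j=k}^t f_\theta(p_{n,j})\,d\Pi(\theta)$, $S_{n,t}^{(w)}:=\sum_{k=1}^tw_kM_{n,k,t}$, $Z_{n,t}^{(w)}:=\max_{1\le k\le t}w_kM_{n,k,t}$, $\tau_{n,S,w}(b):=\inf\{t\ge1:S_{n,t}^{(w)}\ge b\}$, $\tau_{n,Z,w}(b):=\inf\{t\ge1:Z_{n,t}^{(w)}\ge b\}$ ($\inf\varnothing=\infty$). Put $W_t:=\sum_{k=1}^tw_k$,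 $\mathcal B_{n,w}(b_n):=\log\frac{b_n}{w_{T_n+1}}$ (with $\log(b/0)=+\infty$), and $q_{n,w}(b_n):=1-\min\{1,W_{T_n}/b_n\}$. $F_{P_0}$ is the CDF of $P_0$ and $H(t):=\mathbb P_{Y\sim P_1}\{F_{P_0}(Y)\le t\}$, $t\in[0,1]$. $H$ also denotes the law with this CDF, and $U$ is the uniform law on $[0,1]$. *)

theory Defs
  imports "HOL-Probability.Probability"
begin

text \<open>The uniform law \<open>U\<close>, carried by \<open>[0,1]\<close> itself rather than by the whole line, so that
  every randomizer and every p-value lies in \<open>[0,1]\<close> surely and the detector densities need
  only be given (and measurable) there.\<close>

definition unif01 :: "real measure" where
  "unif01 = restrict_space lborel {0..1}"

text \<open>The law of one row \<open>(X\<^sub>j)\<close>, \<open>j \<ge> 1\<close>, with changepoint \<open>T\<close>, jointly with its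
  randomizers \<open>(\<lambda>\<^sub>j)\<close>, \<open>j \<ge> 1\<close>. A sample point is a pair
  \<open>\<omega> = (x, u)\<close> of sequences: the row and the randomizers are the coordinate projections.\<close>

definition row_law :: "real measure \<Rightarrow> nat \<Rightarrow> real measure \<Rightarrow> ((nat \<Rightarrow> real) \<times> (nat \<Rightarrow> real)) measure" where
  "row_law P0 T P1 =
     (\<Pi>\<^sub>M j\<in>{1..}. if j \<le> T then P0 else P1) \<Otimes>\<^sub>M (\<Pi>\<^sub>M j\<in>{1..}. unif01)"

definition conformal_p :: "(nat \<Rightarrow> real) \<times> (nat \<Rightarrow> real) \<Rightarrow> nat \<Rightarrow> real" where
  "conformal_p \<omega> j = (case \<omega> of (x, u) \<Rightarrow>
     ((\<Sum>i=1..j. of_bool (x i < x j)) + u j * (\<Sum>i=1..j. of_bool (x i = x j))) / real j)"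

text \<open>\<open>H(t) = P\<^sub>1{F(Y) \<le> t}\<close> with \<open>F\<close> the CDF of \<open>P\<^sub>0\<close>, and the law on \<open>[0,1]\<close> having this CDF.\<close>

definition H_cdf :: "real measure \<Rightarrow> real measure \<Rightarrow> real \<Rightarrow> real" where
  "H_cdf P0 P1 t = \<P>(y in P1. cdf P0 y \<le> t)"

definition H_law :: "real measure \<Rightarrow> real measure \<Rightarrow> real measure" where
  "H_law P0 P1 = distr P1 (restrict_space borel {0..1}) (cdf P0)"

lemma cdf_measurable_unit_interval:
  assumes "real_distribution P0" "real_distribution P1"
  shows "cdf P0 \<in> P1 \<rightarrow>\<^sub>M restrict_space borel {0..1}"
proof (rule measurable_restrict_space2)
  interpret P0: real_distribution P0 by fact
  interpret P1: real_distribution P1 by fact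
  show "cdf P0 \<in> space P1 \<rightarrow> {0..1}"
    by (auto simp: cdf_def)
  have "mono (cdf P0)"
    by (auto intro!: monoI P0.cdf_nondecreasing)
  then have "cdf P0 \<in> borel_measurable borel"
    by (rule borel_measurable_mono)
  then show "cdf P0 \<in> borel_measurable P1"
    by (simp add: measurable_cong_sets[OF P1.events_eq_borel refl])
qed

lemma H_law_cdf:
  assumes "real_distribution P0" "real_distribution P1" "t \<in> {0..1}"
  shows "measure (H_law P0 P1) {0..t} = H_cdf P0 P1 t"
proof -
  have "{0..t} \<in> sets (restrict_space borel {0..1::real})"
    using assms(3) by (auto simp: sets_restrict_space_iff)
  then have "measure (H_law P0 P1) {0..t} = measure P1 (cdf P0 -` {0..t} \<inter> space P1)"
    unfolding H_law_def
    by (intro measure_distr cdf_measurable_unit_interval assms)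
  also have "cdf P0 -` {0..t} \<inter> space P1 = {y \<in> space P1. cdf P0 y \<le> t}"
    by (auto simp: cdf_def)
  finally show ?thesis
    by (simp add: H_cdf_def)
qed

text \<open>Logarithm on \<open>[0,\<infinity>]\<close>, with \<open>log 0 = -\<infinity>\<close> and \<open>log \<infinity> = \<infinity>\<close>.\<close>

definition elog :: "ennreal \<Rightarrow> ereal" where
  "elog x = (if x = 0 then -\<infinity> else if x = \<infinity> then \<infinity> else ereal (ln (enn2real x)))"

text \<open>\<open>\<integral> \<Prod>\<^sub>j f\<^sub>\<theta>(z\<^sub>j) d\<mu>(\<theta>)\<close> over \<open>k \<le> j \<le> t\<close>, \<open>\<mu>\<close> being the prior; it may be infinite at exceptional points.\<close>

definition mixture :: "'p measure \<Rightarrow> ('p \<Rightarrow> real \<Rightarrow> real) \<Rightarrow> (nat \<Rightarrow> real) \<Rightarrow> nat \<Rightarrow> nat \<Rightarrow> ennreal" where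
  "mixture \<mu> f z k t = (\<integral>\<^sup>+\<theta>. (\<Prod>j=k..t. ennreal (f \<theta> (z j))) \<partial>\<mu>)"

definition stat_S :: "'p measure \<Rightarrow> ('p \<Rightarrow> real \<Rightarrow> real) \<Rightarrow> (nat \<Rightarrow> real) \<Rightarrow>
    (nat \<Rightarrow> real) \<times> (nat \<Rightarrow> real) \<Rightarrow> nat \<Rightarrow> ennreal" where
  "stat_S \<mu> f w \<omega> t = (\<Sum>k=1..t. ennreal (w k) * mixture \<mu> f (conformal_p \<omega>) k t)"

definition stat_Z :: "'p measure \<Rightarrow> ('p \<Rightarrow> real \<Rightarrow> real) \<Rightarrow> (nat \<Rightarrow> real) \<Rightarrow>
    (nat \<Rightarrow> real) \<times> (nat \<Rightarrow> real) \<Rightarrow> nat \<Rightarrow> ennreal" where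
  "stat_Z \<mu> f w \<omega> t = (MAX k\<in>{1..t}. ennreal (w k) * mixture \<mu> f (conformal_p \<omega>) k t)"

definition tau_S :: "'p measure \<Rightarrow> ('p \<Rightarrow> real \<Rightarrow> real) \<Rightarrow> (nat \<Rightarrow> real) \<Rightarrow> real \<Rightarrow>
    (nat \<Rightarrow> real) \<times> (nat \<Rightarrow> real) \<Rightarrow> enat" where
  "tau_S \<mu> f w b \<omega> = Inf {enat t |t. 1 \<le> t \<and> ennreal b \<le> stat_S \<mu> f w \<omega> t}"

definition tau_Z :: "'p measure \<Rightarrow> ('p \<Rightarrow> real \<Rightarrow> real) \<Rightarrow> (nat \<Rightarrow> real) \<Rightarrow> real \<Rightarrow>
    (nat \<Rightarrow> real) \<times> (nat \<Rightarrow> real) \<Rightarrow> enat" where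
  "tau_Z \<mu> f w b \<omega> = Inf {enat t |t. 1 \<le> t \<and> ennreal b \<le> stat_Z \<mu> f w \<omega> t}"

text \<open>The information barrier \<open>log (b / w\<^sub>T\<^sub>+\<^sub>1)\<close>: for \<open>b > 0\<close> the division of \<^typ>\<open>ennreal\<close> gives
  \<open>b / 0 = \<infinity>\<close>, hence the value \<open>\<infinity>\<close> when the weight vanishes.\<close>

definition barrier :: "(nat \<Rightarrow> real) \<Rightarrow> nat \<Rightarrow> real \<Rightarrow> ereal" where
  "barrier w T b = elog (ennreal b / ennreal (w (T + 1)))"

definition q_bound :: "(nat \<Rightarrow> real) \<Rightarrow> nat \<Rightarrow> real \<Rightarrow> real" where
  "q_bound w T b = 1 - min 1 ((\<Sum>k=1..T. w k) / b)"

lemma barrier_eq: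
  assumes "0 < b" "0 \<le> w (T + 1)"
  shows "barrier w T b = (if w (T + 1) = 0 then \<infinity> else ereal (ln (b / w (T + 1))))"
  using assms by (auto simp: barrier_def elog_def divide_ennreal ennreal_divide_zero)

end

theory Submission
  imports Defs
begin

text \<open>Before the change the conformal p-values are i.i.d. uniform (independence of sequential ranks), so
  the sum statistic minus its total weight is a martingale, and a maximal inequality bounds the probability
  of a false alarm by \<open>W\<^sub>T / b\<close>; as \<open>Z \<le> S\<close>, this covers both detectors. After the change, a window of
  \<open>r = o(T)\<close> further observations hardly alters the empirical CDF of the first \<open>T\<close>, so \<open>p\<^sub>j\<close> is close in mean to
  \<open>F(X\<^sub>j)\<close>, which is i.i.d. with density \<open>h\<close>. By the weak law of large numbers the log-likelihood of the window
  starting at \<open>T + 1\<close> is about \<open>r\<close> times the divergence, and the lower bound on the mixture turns this into a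
  crossing once \<open>r\<close> exceeds the barrier divided by the divergence.\<close>

subsection \<open>The uniform law and conformal p-values\<close>

text \<open>All limits follow from two estimates: \<tau> rarely exceeds
  \<open>T + A * barrier\<close>, and no alarm up to \<open>T\<close> has probability at least
  \<open>q_bound\<close>. Since \<open>tau_S \<le> tau_Z\<close>, the first is proved for
  \<open>tau_Z\<close> and the second for \<open>tau_S\<close>; each passes to the other detector.
  The obstacle after the change is that the p-values are dependent and not identically distributed.
  Their joint law is never computed: each is compared with \<open>cdf P0 (X j)\<close> on the same
  sample point, and only first absolute moments of the differences are added up, for which
  dependence is harmless. The Lipschitz property of \<open>ln h\<close> carries this over to the
  log-likelihood. Before the change the vector of p-values is pushed forward to a product of uniform
  laws, where a conditional expectation given the past is an integral over one fresh coordinate. The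
  constant \<open>A\<close> fixes the window length \<open>\<lfloor>A * \<beta>\<rfloor>\<close>,
  \<open>\<beta>\<close> being the barrier: as \<open>A * K > 1\<close> for the divergence
  \<open>K\<close>, the window length times \<open>K\<close> exceeds \<open>\<beta>\<close> by a
  fixed fraction of the window, which pays both for the random error and for the loss
  \<open>a * ln r + c\<close> of the mixture.\<close>

lemma space_unif01 [simp]: "space unif01 = {0..1}"
  by (simp add: unif01_def space_restrict_space)

lemma sets_unif01: "sets unif01 = sets (restrict_space borel {0..1})"
  by (simp add: unif01_def sets_restrict_space)

lemma nn_integral_unif01:
  "(\<integral>\<^sup>+x. g x \<partial>unif01) = (\<integral>\<^sup>+x. g x * indicator {0..1} x \<partial>lborel)"
  unfolding unif01_def by (rule nn_integral_restrict_space) simp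

lemma prob_space_unif01: "prob_space unif01"
  by (rule prob_spaceI) (simp add: unif01_def emeasure_restrict_space)

lemma measurable_unif01_borel [measurable]: "(\<lambda>x. x) \<in> unif01 \<rightarrow>\<^sub>M borel"
  by (simp add: unif01_def measurable_restrict_space1)

lemma measurable_to_unif01I:
  assumes "g \<in> M \<rightarrow>\<^sub>M borel" "\<And>x. x \<in> space M \<Longrightarrow> g x \<in> {0..1}"
  shows "g \<in> M \<rightarrow>\<^sub>M unif01"
proof -
  have "g \<in> M \<rightarrow>\<^sub>M restrict_space borel {0..1}"
    using assms by (intro measurable_restrict_space2) auto
  then show ?thesis
    by (simp add: measurable_cong_sets[OF refl sets_unif01])
qed

lemma conformal_p_bounds:
  assumes "1 \<le> j" "u j \<in> {0..1}"
  shows "conformal_p (x, u) j \<in> {0..1}"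
proof -
  let ?L = "\<Sum>i=1..j. of_bool (x i < x j) :: real" and ?E = "\<Sum>i=1..j. of_bool (x i = x j) :: real"
  have "?L + ?E = (\<Sum>i=1..j. of_bool (x i < x j) + of_bool (x i = x j))"
    by (simp only: sum.distrib)
  also have "\<dots> \<le> (\<Sum>i=1..j. 1)"
    by (intro sum_mono) auto
  finally have le: "?L + ?E \<le> real j"
    by simp
  have E: "0 \<le> ?E" and L: "0 \<le> ?L"
    by (auto intro!: sum_nonneg)
  have "u j * ?E \<le> 1 * ?E"
    using assms E by (intro mult_right_mono) auto
  moreover have "0 \<le> u j * ?E"
    using assms E by auto
  ultimately show ?thesis
    using le L assms(1) by (simp add: conformal_p_def field_simps)
qed

lemma measurable_PiM_coordinate_borel:
  assumes "j \<in> I" "sets (A j) = sets borel"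
  shows "(\<lambda>x. x j) \<in> borel_measurable (PiM I A)"
  using measurable_component_singleton[OF assms(1), of A]
  by (simp add: measurable_cong_sets[OF refl assms(2)])

text \<open>Index sets and coordinate laws stay open because p-values are needed both on the row
  law, with infinite index sets and two laws, and on finite products of \<open>P0\<close> whose data
  and randomizers may differ in number.\<close>

lemma measurable_conformal_p:
  assumes A: "\<And>i. i \<in> I \<Longrightarrow> sets (A i) = sets borel" and I: "{1..j} \<subseteq> I" and J: "j \<in> J" and j: "1 \<le> j"
  shows "(\<lambda>\<omega>. conformal_p \<omega> j) \<in> (PiM I A \<Otimes>\<^sub>M PiM J (\<lambda>_. unif01)) \<rightarrow>\<^sub>M unif01"
proof (rule measurable_to_unif01I)
  have x [measurable]: "(\<lambda>\<omega>. fst \<omega> i) \<in> (PiM I A \<Otimes>\<^sub>M PiM J (\<lambda>_. unif01)) \<rightarrow>\<^sub>M borel" if "i \<in> {1..j}" for i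
  proof -
    have "i \<in> I"
      using that I by auto
    then have "(\<lambda>x. x i) \<in> PiM I A \<rightarrow>\<^sub>M borel"
      by (intro measurable_PiM_coordinate_borel A)
    then show ?thesis
      by measurable
  qed
  have u [measurable]: "(\<lambda>\<omega>. snd \<omega> j) \<in> (PiM I A \<Otimes>\<^sub>M PiM J (\<lambda>_. unif01)) \<rightarrow>\<^sub>M borel"
  proof -
    have "(\<lambda>u. u j) \<in> PiM J (\<lambda>_. unif01) \<rightarrow>\<^sub>M unif01"
      using J by (rule measurable_component_singleton)
    from measurable_compose[OF this measurable_unif01_borel] show ?thesis
      by measurable
  qed
  have [measurable]: "(\<lambda>\<omega>. fst \<omega> j) \<in> (PiM I A \<Otimes>\<^sub>M PiM J (\<lambda>_. unif01)) \<rightarrow>\<^sub>M borel"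
    by (rule x) (use j in auto)
  show "(\<lambda>\<omega>. conformal_p \<omega> j) \<in> (PiM I A \<Otimes>\<^sub>M PiM J (\<lambda>_. unif01)) \<rightarrow>\<^sub>M borel"
    unfolding conformal_p_def case_prod_beta
  proof (intro borel_measurable_divide borel_measurable_add borel_measurable_times borel_measurable_sum u)
    fix i assume [measurable]: "i \<in> {1..j}"
    show "(\<lambda>\<omega>. of_bool (fst \<omega> i < fst \<omega> j) :: real) \<in> borel_measurable (PiM I A \<Otimes>\<^sub>M PiM J (\<lambda>_. unif01))"
      by measurable
    show "(\<lambda>\<omega>. of_bool (fst \<omega> i = fst \<omega> j) :: real) \<in> borel_measurable (PiM I A \<Otimes>\<^sub>M PiM J (\<lambda>_. unif01))"
      by measurable
  qed auto
  show "conformal_p \<omega> j \<in> {0..1}" if "\<omega> \<in> space (PiM I A \<Otimes>\<^sub>M PiM J (\<lambda>_. unif01))" for \<omega>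
  proof -
    have "snd \<omega> \<in> space (PiM J (\<lambda>_. unif01))"
      using that by (auto simp: space_pair_measure)
    then have "snd \<omega> j \<in> {0..1}"
      using J by (auto simp: space_PiM PiE_def Pi_def)
    then show ?thesis
      using conformal_p_bounds[of j "snd \<omega>" "fst \<omega>"] j by simp
  qed
qed

subsection \<open>Independence and uniformity of the p-values before the change\<close>

text \<open>The maps \<open>v \<mapsto> (r + v) / n\<close> for \<open>r < n\<close> scale lengths
  by \<open>1 / n\<close> and tile the unit interval. In probabilistic terms, a uniform rank in
  \<open>{..<n}\<close> plus an independent uniform randomizer, divided by \<open>n\<close>, is
  uniform.\<close>

lemma sum_nn_integral_unif01_shift:
  assumes A: "A \<in> sets unif01" and n: "0 < n"
  shows "(\<Sum>r<n. \<integral>\<^sup>+v. indicator A ((real r + v) / real n) \<partial>unif01) = of_nat n * emeasure unif01 A"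
proof -
  have A': "A \<in> sets borel" "A \<subseteq> {0..1}"
    using A by (auto simp: sets_unif01 sets_restrict_space_iff)
  note [measurable] = A'(1)
  let ?g = "\<lambda>y. indicator A y :: ennreal"
  let ?J = "\<lambda>r. {real r / real n ..< (real r + 1) / real n}"
  \<comment> \<open>Dropping the right endpoint, a null set, makes the \<open>n\<close> pieces
    half-open, so that they are disjoint and their indicators add up exactly.\<close>
  have no_one: "(\<integral>\<^sup>+v. u v * indicator {0..1} v \<partial>lborel) = (\<integral>\<^sup>+v. u v * indicator {0..<1} v \<partial>lborel)"
    for u :: "real \<Rightarrow> ennreal"
  proof (rule nn_integral_cong_AE)
    show "AE v in lborel. u v * indicator {0..1} v = u v * indicator {0..<1} v"
      using AE_lborel_singleton[of 1] by eventually_elim (auto simp: indicator_def)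
  qed
  have piece: "(\<integral>\<^sup>+v. ?g ((real r + v) / real n) \<partial>unif01)
      = of_nat n * (\<integral>\<^sup>+y. ?g y * indicator (?J r) y \<partial>lborel)" for r
  proof -
    have ind: "indicator (?J r) (real r / real n + 1 / real n * v) = (indicator {0..<1} v :: ennreal)" for v
      using n by (auto simp: indicator_def field_simps)
    have "(\<integral>\<^sup>+y. ?g y * indicator (?J r) y \<partial>lborel)
        = ennreal \<bar>1 / real n\<bar> * (\<integral>\<^sup>+v. ?g (real r / real n + 1 / real n * v)
            * indicator (?J r) (real r / real n + 1 / real n * v) \<partial>lborel)"
      using n by (intro nn_integral_real_affine) auto
    also have "\<dots> = ennreal (1 / real n) * (\<integral>\<^sup>+v. ?g ((real r + v) / real n) * indicator {0..<1} v \<partial>lborel)"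
      unfolding ind using n by (simp add: add_divide_distrib)
    finally have "of_nat n * (\<integral>\<^sup>+y. ?g y * indicator (?J r) y \<partial>lborel)
        = (of_nat n * ennreal (1 / real n)) * (\<integral>\<^sup>+v. ?g ((real r + v) / real n) \<partial>unif01)"
      unfolding nn_integral_unif01 no_one by (simp add: mult.assoc)
    moreover have "of_nat n * ennreal (1 / real n) = 1"
      using n by (simp add: ennreal_of_nat_eq_real_of_nat ennreal_mult[symmetric])
    ultimately show ?thesis
      by simp
  qed
  have cover: "(\<Sum>r<m. indicator (?J r) y) = (indicator {0..<real m / real n} y :: ennreal)" for m y
  proof (induction m)
    case (Suc m)
    have "{0..<real (Suc m) / real n} = {0..<real m / real n} \<union> ?J m" "{0..<real m / real n} \<inter> ?J m = {}"
      using n ivl_disj_un_two(3)[of 0 "real m / real n" "real (Suc m) / real n"]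
      by (auto simp: divide_right_mono add.commute)
    then show ?case
      by (simp add: Suc.IH indicator_add)
  qed simp
  have "(\<Sum>r<n. \<integral>\<^sup>+v. ?g ((real r + v) / real n) \<partial>unif01)
      = of_nat n * (\<Sum>r<n. \<integral>\<^sup>+y. ?g y * indicator (?J r) y \<partial>lborel)"
    unfolding piece by (rule sum_distrib_left[symmetric])
  also have "(\<Sum>r<n. \<integral>\<^sup>+y. ?g y * indicator (?J r) y \<partial>lborel)
      = (\<integral>\<^sup>+y. (\<Sum>r<n. ?g y * indicator (?J r) y) \<partial>lborel)"
    by (intro nn_integral_sum[symmetric]) auto
  also have "\<dots> = (\<integral>\<^sup>+y. ?g y * indicator {0..<1} y \<partial>lborel)"
    unfolding sum_distrib_left[symmetric] cover using n by simp
  also have "\<dots> = (\<integral>\<^sup>+y. ?g y \<partial>unif01)"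
    unfolding nn_integral_unif01 no_one ..
  also have "\<dots> = emeasure unif01 A"
    using A by simp
  finally show ?thesis .
qed

text \<open>Without ties, the number of smaller values is an injective function of the index with
  values below \<open>n\<close>, hence a bijection onto \<open>{..<n}\<close>.\<close>

lemma sum_over_ranks:
  fixes x :: "nat \<Rightarrow> real" and g :: "nat \<Rightarrow> 'c::comm_monoid_add"
  assumes inj: "inj_on x {1..n}"
  shows "(\<Sum>i=1..n. g (card {k\<in>{1..n}. x k < x i})) = (\<Sum>r<n. g r)"
proof -
  define r where "r i = card {k\<in>{1..n}. x k < x i}" for i
  have less: "r i < r j" if "i \<in> {1..n}" "j \<in> {1..n}" "x i < x j" for i j
    unfolding r_def by (rule psubset_card_mono) (use that in auto)
  have r_inj: "inj_on r {1..n}"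
  proof (rule inj_onI)
    fix i j assume ij: "i \<in> {1..n}" "j \<in> {1..n}" "r i = r j"
    then have "x i = x j"
      using less[of i j] less[of j i] by (cases "x i" "x j" rule: linorder_cases) auto
    then show "i = j"
      using inj ij by (auto dest: inj_onD)
  qed
  have r_less: "r i < n" if "i \<in> {1..n}" for i
  proof -
    have "{k\<in>{1..n}. x k < x i} \<subset> {1..n}"
      using that by blast
    from psubset_card_mono[OF _ this] show ?thesis
      by (simp add: r_def)
  qed
  have "r ` {1..n} = {..<n}"
    by (rule card_subset_eq) (use r_less r_inj in \<open>auto simp: card_image\<close>)
  with r_inj have "bij_betw r {1..n} {..<n}"
    by (simp add: bij_betw_def)
  from sum.reindex_bij_betw[OF this, of g] show ?thesis
    by (simp add: r_def)
qed

text \<open>Continuity of the CDF excludes atoms. With the other coordinates fixed, a tie forces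
  \<open>x i\<close> to hit a single point, so every one of the finitely many ties is a null event
  by integrating over \<open>x i\<close> first.\<close>

lemma AE_PiM_inj_on:
  assumes P0: "real_distribution P0" and cont: "continuous_on UNIV (cdf P0)"
  shows "AE x in PiM {1..n::nat} (\<lambda>_. P0). inj_on x {1..n}"
proof -
  interpret P0: real_distribution P0 by fact
  interpret product_sigma_finite "\<lambda>_. P0"
    by standard
  have atom: "emeasure P0 {y} = 0" for y
  proof -
    have "isCont (cdf P0) y"
      using cont by (simp add: continuous_on_eq_continuous_at)
    then show ?thesis
      by (simp add: P0.isCont_cdf P0.emeasure_eq_measure)
  qed
  have neq: "AE x in PiM {1..n} (\<lambda>_. P0). x i \<noteq> x k" if ik: "i \<in> {1..n}" "k \<in> {1..n}" "i \<noteq> k" for i k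
  proof -
    have ins: "{1..n} = insert i ({1..n} - {i})"
      using ik by auto
    let ?f = "\<lambda>x. of_bool (x i = (x k :: real)) :: ennreal"
    have "(\<lambda>x. x j) \<in> borel_measurable (PiM (insert i ({1..n} - {i})) (\<lambda>_. P0))" if "j \<in> {i, k}" for j
      using that ik by (intro measurable_PiM_coordinate_borel) auto
    then have [measurable]: "Measurable.pred (PiM (insert i ({1..n} - {i})) (\<lambda>_. P0)) (\<lambda>x. x i = (x k :: real))"
      unfolding pred_def by (intro borel_measurable_eq) auto
    have m: "?f \<in> borel_measurable (PiM (insert i ({1..n} - {i})) (\<lambda>_. P0))"
      by measurable
    have "(\<integral>\<^sup>+x. ?f x \<partial>PiM (insert i ({1..n} - {i})) (\<lambda>_. P0))
        = (\<integral>\<^sup>+x. (\<integral>\<^sup>+y. ?f (x(i := y)) \<partial>P0) \<partial>PiM ({1..n} - {i}) (\<lambda>_. P0))"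
      by (rule product_nn_integral_insert[OF _ _ m]) auto
    also have "\<dots> = (\<integral>\<^sup>+x. (\<integral>\<^sup>+y. indicator {x k} y \<partial>P0) \<partial>PiM ({1..n} - {i}) (\<lambda>_. P0))"
      using ik by (intro nn_integral_cong) (auto simp: indicator_def of_bool_def)
    also have "\<dots> = 0"
      by (simp add: atom)
    finally have "AE x in PiM (insert i ({1..n} - {i})) (\<lambda>_. P0). ?f x = 0"
      by (subst (asm) nn_integral_0_iff_AE[OF m])
    then show ?thesis
      unfolding ins[symmetric]
      by eventually_elim (auto simp: of_bool_def split: if_splits)
  qed
  have "AE x in PiM {1..n} (\<lambda>_. P0). \<forall>i\<in>{1..n}. \<forall>k\<in>{1..n}. i \<noteq> k \<longrightarrow> x i \<noteq> x k"
    by (intro AE_finite_allI finite_atLeastAtMost) (auto intro: neq)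
  then show ?thesis
    by eventually_elim (auto simp: inj_on_def)
qed

lemma nn_integral_PiM_permute:
  assumes M: "prob_space M" and \<pi>: "\<pi> permutes I" and g: "g \<in> borel_measurable (PiM I (\<lambda>_. M))"
  shows "(\<integral>\<^sup>+x. g (x \<circ> \<pi>) \<partial>PiM I (\<lambda>_. M)) = (\<integral>\<^sup>+x. g x \<partial>PiM I (\<lambda>_. M))"
proof -
  have \<pi>': "inj_on \<pi> I" "\<pi> \<in> I \<rightarrow> I"
    using \<pi> by (auto simp: permutes_inj_on permutes_in_image)
  have "(\<integral>\<^sup>+x. g x \<partial>PiM I (\<lambda>_. M))
      = (\<integral>\<^sup>+x. g x \<partial>distr (PiM I (\<lambda>_. M)) (PiM I (\<lambda>_. M)) (\<lambda>x. \<lambda>n\<in>I. x (\<pi> n)))"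
    using distr_PiM_reindex[of I "\<lambda>_. M" \<pi> I] M \<pi>' by simp
  also have "\<dots> = (\<integral>\<^sup>+x. g (\<lambda>n\<in>I. x (\<pi> n)) \<partial>PiM I (\<lambda>_. M))"
  proof (rule nn_integral_distr)
    show "(\<lambda>x. \<lambda>n\<in>I. x (\<pi> n)) \<in> PiM I (\<lambda>_. M) \<rightarrow>\<^sub>M PiM I (\<lambda>_. M)"
      using \<pi>' by (intro measurable_restrict measurable_component_singleton) auto
  qed (use g in simp)
  also have "\<dots> = (\<integral>\<^sup>+x. g (x \<circ> \<pi>) \<partial>PiM I (\<lambda>_. M))"
  proof (intro nn_integral_cong arg_cong[where f = g] ext)
    fix x k assume "x \<in> space (PiM I (\<lambda>_. M))"
    then show "(\<lambda>n\<in>I. x (\<pi> n)) k = (x \<circ> \<pi>) k"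
      using \<pi> by (auto simp: space_PiM PiE_def extensional_def permutes_def)
  qed
  finally show ?thesis ..
qed

text \<open>The conditional probability, given all \<open>n\<close> observations, that observation
  \<open>i\<close> ranked among them has its randomized rank in \<open>A\<close>. The conformal
  p-value is the case \<open>i = n\<close>; the other \<open>i\<close> are included so that
  permuting the observations stays within the family.\<close>

definition cond_prob_p :: "real set \<Rightarrow> nat \<Rightarrow> nat \<Rightarrow> (nat \<Rightarrow> real) \<Rightarrow> ennreal" where
  "cond_prob_p A n i x = (\<integral>\<^sup>+v. indicator A
     (((\<Sum>k=1..n. of_bool (x k < x i)) + v * (\<Sum>k=1..n. of_bool (x k = x i))) / real n) \<partial>unif01)"

lemma cond_prob_p_permute:
  assumes "\<pi> permutes {1..n}"
  shows "cond_prob_p A n i (x \<circ> \<pi>) = cond_prob_p A n (\<pi> i) x"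
proof -
  have "(\<Sum>k=1..n. of_bool (x (\<pi> k) < x (\<pi> i)) :: real) = (\<Sum>k=1..n. of_bool (x k < x (\<pi> i)))"
    "(\<Sum>k=1..n. of_bool (x (\<pi> k) = x (\<pi> i)) :: real) = (\<Sum>k=1..n. of_bool (x k = x (\<pi> i)))"
    using sum.permute[OF assms, of "\<lambda>k. of_bool (x k < x (\<pi> i)) :: real"]
      sum.permute[OF assms, of "\<lambda>k. of_bool (x k = x (\<pi> i)) :: real"] by (simp_all add: comp_def)
  then show ?thesis
    by (simp add: cond_prob_p_def)
qed

lemma sum_cond_prob_p:
  assumes A: "A \<in> sets unif01" and n: "0 < n" and inj: "inj_on x {1..n}"
  shows "(\<Sum>i=1..n. cond_prob_p A n i x) = of_nat n * emeasure unif01 A"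
proof -
  have "cond_prob_p A n i x
      = (\<integral>\<^sup>+v. indicator A ((real (card {k\<in>{1..n}. x k < x i}) + v) / real n) \<partial>unif01)"
    if i: "i \<in> {1..n}" for i
  proof -
    have "{k\<in>{1..n}. x k = x i} = {i}"
      using inj i by (auto dest: inj_onD)
    then have "(\<Sum>k=1..n. of_bool (x k = x i)) = (1 :: real)"
      by (simp add: Int_def)
    moreover have "(\<Sum>k=1..n. of_bool (x k < x i)) = real (card {k\<in>{1..n}. x k < x i})"
      by (simp add: Int_def)
    ultimately show ?thesis
      by (simp add: cond_prob_p_def)
  qed
  then have "(\<Sum>i=1..n. cond_prob_p A n i x) = (\<Sum>i=1..n. (\<lambda>r. \<integral>\<^sup>+v. indicator A ((real r + v) / real n) \<partial>unif01)
      (card {k\<in>{1..n}. x k < x i}))"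
    by (intro sum.cong) auto
  also have "\<dots> = (\<Sum>r<n. \<integral>\<^sup>+v. indicator A ((real r + v) / real n) \<partial>unif01)"
    by (rule sum_over_ranks[OF inj])
  also have "\<dots> = of_nat n * emeasure unif01 A"
    by (rule sum_nn_integral_unif01_shift[OF A n])
  finally show ?thesis .
qed

lemma borel_measurable_cond_prob_p:
  assumes A: "A \<in> sets unif01" and P0: "sets P0 = sets borel" and i: "i \<in> {1..n}"
  shows "cond_prob_p A n i \<in> borel_measurable (PiM {1..n} (\<lambda>_. P0))"
proof -
  interpret U: prob_space unif01
    by (rule prob_space_unif01)
  have A' [measurable]: "A \<in> sets borel"
    using A by (auto simp: sets_unif01 sets_restrict_space_iff)
  have c [measurable]: "(\<lambda>x. x k) \<in> borel_measurable (PiM {1..n} (\<lambda>_. P0))" if "k \<in> {1..n}" for k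
    using that P0 by (intro measurable_PiM_coordinate_borel) auto
  note ci [measurable] = c[OF i]
  have "(\<lambda>x. (\<Sum>k=1..n. of_bool (x k < x i)) :: real) \<in> borel_measurable (PiM {1..n} (\<lambda>_. P0))"
    "(\<lambda>x. (\<Sum>k=1..n. of_bool (x k = x i)) :: real) \<in> borel_measurable (PiM {1..n} (\<lambda>_. P0))"
  proof (safe intro!: borel_measurable_sum)
    fix k assume "k \<in> {1..n}"
    note [measurable] = c[OF this]
    have "{x \<in> space (PiM {1..n} (\<lambda>_. P0)). x k = x i} \<in> sets (PiM {1..n} (\<lambda>_. P0))"
      by (intro borel_measurable_eq c i \<open>k \<in> {1..n}\<close>)
    then have [measurable]: "Measurable.pred (PiM {1..n} (\<lambda>_. P0)) (\<lambda>x. x k = x i)"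
      by (simp add: pred_def)
    have "{x \<in> space (PiM {1..n} (\<lambda>_. P0)). x k < x i} \<in> sets (PiM {1..n} (\<lambda>_. P0))"
      by (intro borel_measurable_less c i \<open>k \<in> {1..n}\<close>)
    then have [measurable]: "Measurable.pred (PiM {1..n} (\<lambda>_. P0)) (\<lambda>x. x k < x i)"
      by (simp add: pred_def)
    show "(\<lambda>x. of_bool (x k < x i) :: real) \<in> borel_measurable (PiM {1..n} (\<lambda>_. P0))"
      "(\<lambda>x. of_bool (x k = x i) :: real) \<in> borel_measurable (PiM {1..n} (\<lambda>_. P0))"
      by measurable
  qed
  note [measurable] = this
  show ?thesis
    unfolding cond_prob_p_def[abs_def]
    by (intro U.borel_measurable_nn_integral) measurable
qed

text \<open>Exchanging \<open>x i\<close> with the last observation shows that every \<open>i\<close> contributes equally to the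
  integral, while the contributions of all \<open>i\<close> add up to a constant off the null set of ties.\<close>

lemma nn_integral_symmetric_cond_prob_p:
  assumes P0: "real_distribution P0" and cont: "continuous_on UNIV (cdf P0)"
    and A: "A \<in> sets unif01" and n: "0 < n"
    and S: "S \<in> borel_measurable (PiM {1..n} (\<lambda>_. P0))"
    and sym: "\<And>\<pi> x. \<pi> permutes {1..n} \<Longrightarrow> x \<in> space (PiM {1..n} (\<lambda>_. P0)) \<Longrightarrow> S (x \<circ> \<pi>) = S x"
  shows "(\<integral>\<^sup>+x. S x * cond_prob_p A n n x \<partial>PiM {1..n} (\<lambda>_. P0))
    = (\<integral>\<^sup>+x. S x \<partial>PiM {1..n} (\<lambda>_. P0)) * emeasure unif01 A"
proof -
  interpret P0: real_distribution P0 by fact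
  let ?X = "PiM {1..n} (\<lambda>_. P0)"
  have c [measurable]: "cond_prob_p A n i \<in> borel_measurable ?X" if "i \<in> {1..n}" for i
    by (rule borel_measurable_cond_prob_p[OF A _ that]) simp
  have eq: "(\<integral>\<^sup>+x. S x * cond_prob_p A n i x \<partial>?X) = (\<integral>\<^sup>+x. S x * cond_prob_p A n n x \<partial>?X)" if i: "i \<in> {1..n}" for i
  proof -
    let ?\<pi> = "Transposition.transpose i n"
    have \<pi>: "?\<pi> permutes {1..n}"
      using i n by (intro permutes_swap_id) auto
    have "(\<integral>\<^sup>+x. S x * cond_prob_p A n n x \<partial>?X) = (\<integral>\<^sup>+x. S (x \<circ> ?\<pi>) * cond_prob_p A n n (x \<circ> ?\<pi>) \<partial>?X)"
      by (rule nn_integral_PiM_permute[symmetric, OF _ \<pi>])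
        (use S c n in \<open>auto intro!: borel_measurable_times P0.prob_space_axioms\<close>)
    also have "\<dots> = (\<integral>\<^sup>+x. S x * cond_prob_p A n i x \<partial>?X)"
      by (intro nn_integral_cong) (simp add: sym[OF \<pi>] cond_prob_p_permute[OF \<pi>])
    finally show ?thesis ..
  qed
  have "of_nat n * (\<integral>\<^sup>+x. S x * cond_prob_p A n n x \<partial>?X)
      = (\<Sum>i=1..n. \<integral>\<^sup>+x. S x * cond_prob_p A n n x \<partial>?X)"
    by simp
  also have "\<dots> = (\<Sum>i=1..n. \<integral>\<^sup>+x. S x * cond_prob_p A n i x \<partial>?X)"
    by (intro sum.cong refl eq[symmetric])
  also have "\<dots> = (\<integral>\<^sup>+x. (\<Sum>i=1..n. S x * cond_prob_p A n i x) \<partial>?X)"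
    using S c by (intro nn_integral_sum[symmetric]) auto
  also have "\<dots> = (\<integral>\<^sup>+x. S x * (of_nat n * emeasure unif01 A) \<partial>?X)"
  proof (rule nn_integral_cong_AE)
    show "AE x in ?X. (\<Sum>i=1..n. S x * cond_prob_p A n i x) = S x * (of_nat n * emeasure unif01 A)"
      using AE_PiM_inj_on[OF P0 cont, of n]
      by eventually_elim (simp only: sum_distrib_left[symmetric] sum_cond_prob_p[OF A n])
  qed
  also have "\<dots> = of_nat n * ((\<integral>\<^sup>+x. S x \<partial>?X) * emeasure unif01 A)"
    by (subst nn_integral_multc[OF S]) (simp only: mult.left_commute)
  finally show ?thesis
    using n by (simp add: ennreal_mult_cancel_left ennreal_of_nat_eq_real_of_nat)
qed

lemma conformal_p_cong:
  assumes "\<And>i. i \<in> {1..j} \<Longrightarrow> x i = x' i" "u j = u' j" "1 \<le> j"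
  shows "conformal_p (x, u) j = conformal_p (x', u') j"
proof -
  have "(\<Sum>i=1..j. of_bool (x i < x j)) = (\<Sum>i=1..j. of_bool (x' i < x' j) :: real)"
    "(\<Sum>i=1..j. of_bool (x i = x j)) = (\<Sum>i=1..j. of_bool (x' i = x' j) :: real)"
    using assms by (auto intro!: sum.cong)
  then show ?thesis
    using assms(2) by (simp add: conformal_p_def)
qed

lemma borel_measurable_prod_conformal_p:
  assumes "\<And>j. j \<in> {1..t} \<Longrightarrow> A j \<in> sets unif01" and P0: "sets P0 = sets borel" "t \<le> t1" "t \<le> t2"
  shows "(\<lambda>\<omega>. \<Prod>j=1..t. indicator (A j) (conformal_p \<omega> j) :: ennreal)
    \<in> borel_measurable (PiM {1..t1} (\<lambda>_. P0) \<Otimes>\<^sub>M PiM {1..t2} (\<lambda>_. unif01))"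
proof (intro borel_measurable_prod_ennreal)
  fix j assume j: "j \<in> {1..t}"
  have "(\<lambda>\<omega>. conformal_p \<omega> j) \<in> (PiM {1..t1} (\<lambda>_. P0) \<Otimes>\<^sub>M PiM {1..t2} (\<lambda>_. unif01)) \<rightarrow>\<^sub>M unif01"
    using j P0 by (intro measurable_conformal_p) auto
  from measurable_compose[OF this borel_measurable_indicator[OF assms(1)[OF j]]]
  show "(\<lambda>\<omega>. indicator (A j) (conformal_p \<omega> j) :: ennreal)
    \<in> borel_measurable (PiM {1..t1} (\<lambda>_. P0) \<Otimes>\<^sub>M PiM {1..t2} (\<lambda>_. unif01))" .
qed

text \<open>Carrying along a symmetric weight \<open>S\<close> makes the induction work: the conditional probability of
  the last p-value given the data is not symmetric in all observations, but it is so in the earlier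
  ones once the last observation is fixed.\<close>

lemma nn_integral_symmetric_conformal_p:
  assumes P0: "real_distribution P0" and cont: "continuous_on UNIV (cdf P0)"
    and A: "\<forall>j\<in>{1..t}. A j \<in> sets unif01"
    and S: "S \<in> borel_measurable (PiM {1..t} (\<lambda>_. P0))"
    and sym: "\<forall>\<pi>. \<pi> permutes {1..t} \<longrightarrow> (\<forall>x\<in>space (PiM {1..t} (\<lambda>_. P0)). S (x \<circ> \<pi>) = S x)"
  shows "(\<integral>\<^sup>+x. (\<integral>\<^sup>+u. S x * (\<Prod>j=1..t. indicator (A j) (conformal_p (x, u) j))
        \<partial>PiM {1..t} (\<lambda>_. unif01)) \<partial>PiM {1..t} (\<lambda>_. P0))
    = (\<integral>\<^sup>+x. S x \<partial>PiM {1..t} (\<lambda>_. P0)) * (\<Prod>j=1..t. emeasure unif01 (A j))"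
  using A S sym
proof (induction t arbitrary: S)
  case 0
  have "{1..0::nat} = {}"
    by simp
  then show ?case
    by (simp only: PiM_empty nn_integral_count_space_finite finite.intros prod.empty mult_1_right) simp
next
  case (Suc t)
  interpret P0: real_distribution P0 by fact
  interpret U: prob_space unif01 by (rule prob_space_unif01)
  interpret X: product_prob_space "\<lambda>_::nat. P0" by standard
  interpret V: product_prob_space "\<lambda>_::nat. unif01" by standard
  let ?i = "Suc t" and ?I = "{1..t}"
  let ?X = "PiM ?I (\<lambda>_. P0)" and ?V = "PiM ?I (\<lambda>_. unif01)"
  let ?X' = "PiM {1..Suc t} (\<lambda>_. P0)" and ?V' = "PiM {1..Suc t} (\<lambda>_. unif01)"
  define B where "B \<omega> = (\<Prod>j\<in>?I. indicator (A j) (conformal_p \<omega> j) :: ennreal)" for \<omega>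
  let ?c = "cond_prob_p (A ?i) ?i ?i"
  interpret VI: prob_space ?V by (rule prob_space_PiM) (rule prob_space_unif01)
  interpret XI: prob_space ?X by (rule prob_space_PiM) (rule P0.prob_space_axioms)
  have ins: "{1..Suc t} = insert ?i ?I" by auto
  have sym: "S (x \<circ> \<pi>) = S x" if "\<pi> permutes {1..Suc t}" "x \<in> space ?X'" for \<pi> x
    using Suc.prems(3) that by blast
  have Ai: "A ?i \<in> sets unif01" and AI: "\<And>j. j \<in> ?I \<Longrightarrow> A j \<in> sets unif01"
    using Suc.prems(1) by auto
  note mS [measurable] = Suc.prems(2)
  have mc [measurable]: "?c \<in> borel_measurable ?X'"
    by (rule borel_measurable_cond_prob_p[OF Ai]) auto
  have [measurable]: "B \<in> borel_measurable (?X \<Otimes>\<^sub>M ?V)" "B \<in> borel_measurable (?X' \<Otimes>\<^sub>M ?V)"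
    unfolding B_def by (rule borel_measurable_prod_conformal_p[OF AI]; simp)+
  have V_ins: "(\<integral>\<^sup>+u. g u \<partial>?V') = (\<integral>\<^sup>+u. (\<integral>\<^sup>+v. g (u(?i := v)) \<partial>unif01) \<partial>?V)"
    if "g \<in> borel_measurable ?V'" for g
    using that unfolding ins by (intro V.product_nn_integral_insert) auto
  \<comment> \<open>In this order of integration the last observation \<open>y\<close> is outermost.
    For fixed \<open>y\<close> the inner integral runs over the first \<open>t\<close> observations,
    which is where the induction hypothesis applies.\<close>
  have X_ins: "(\<integral>\<^sup>+x. g x \<partial>?X') = (\<integral>\<^sup>+y. (\<integral>\<^sup>+x. g (x(?i := y)) \<partial>?X) \<partial>P0)"
    if "g \<in> borel_measurable ?X'" for g
    using that unfolding ins by (intro X.product_nn_integral_insert_rev) auto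
  have B_last_u: "B (x, u(?i := v)) = B (x, u)" for x u v
    unfolding B_def by (intro prod.cong refl arg_cong2[where f = indicator] conformal_p_cong) auto
  have B_last_x: "B (x(?i := y), u) = B (x, u)" for x u y
    unfolding B_def by (intro prod.cong refl arg_cong2[where f = indicator] conformal_p_cong) auto

  have B_Suc: "(\<Prod>j=1..Suc t. indicator (A j) (conformal_p \<omega> j))
      = B \<omega> * indicator (A ?i) (conformal_p \<omega> ?i)" for \<omega>
    by (simp add: B_def)
  \<comment> \<open>The last randomizer enters only the last p-value, so integrating it out replaces
    that indicator by the conditional probability \<open>?c\<close> given the data.\<close>
  have inner: "(\<integral>\<^sup>+u. S x * (\<Prod>j=1..Suc t. indicator (A j) (conformal_p (x, u) j)) \<partial>?V')
      = (\<integral>\<^sup>+u. S x * ?c x * B (x, u) \<partial>?V)" if x: "x \<in> space ?X'" for x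
  proof -
    define L E where "L = (\<Sum>k=1..?i. of_bool (x k < x ?i) :: real)"
      and "E = (\<Sum>k=1..?i. of_bool (x k = x ?i) :: real)"
    have A' [measurable]: "A ?i \<in> sets borel"
      using Ai by (auto simp: sets_unif01 sets_restrict_space_iff)
    have c: "?c x = (\<integral>\<^sup>+v. indicator (A ?i) ((L + v * E) / real ?i) \<partial>unif01)"
      by (simp add: cond_prob_p_def L_def E_def)
    have p: "conformal_p (x, u(?i := v)) ?i = (L + v * E) / real ?i" for u v
      by (simp add: conformal_p_def L_def E_def)
    have "(\<lambda>u. \<Prod>j=1..Suc t. indicator (A j) (conformal_p (x, u) j) :: ennreal) \<in> borel_measurable ?V'"
      by (rule measurable_compose[OF measurable_Pair1'[OF x]])
        (rule borel_measurable_prod_conformal_p; use Suc.prems(1) in simp)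
    then have "(\<integral>\<^sup>+u. S x * (\<Prod>j=1..Suc t. indicator (A j) (conformal_p (x, u) j)) \<partial>?V')
      = (\<integral>\<^sup>+u. (\<integral>\<^sup>+v. S x * (\<Prod>j=1..Suc t. indicator (A j) (conformal_p (x, u(?i := v)) j)) \<partial>unif01) \<partial>?V)"
      by (intro V_ins) auto
    also have "\<dots> = (\<integral>\<^sup>+u. (\<integral>\<^sup>+v. (S x * B (x, u)) * indicator (A ?i) ((L + v * E) / real ?i) \<partial>unif01) \<partial>?V)"
      by (intro nn_integral_cong) (simp only: B_Suc B_last_u p mult_ac)
    also have "\<dots> = (\<integral>\<^sup>+u. (S x * B (x, u)) * ?c x \<partial>?V)"
      unfolding c by (intro nn_integral_cong nn_integral_cmult) measurable
    finally show ?thesis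
      by (simp add: mult_ac)
  qed
  have "(\<integral>\<^sup>+x. (\<integral>\<^sup>+u. S x * (\<Prod>j=1..Suc t. indicator (A j) (conformal_p (x, u) j)) \<partial>?V') \<partial>?X')
      = (\<integral>\<^sup>+x. (\<integral>\<^sup>+u. S x * ?c x * B (x, u) \<partial>?V) \<partial>?X')"
    by (intro nn_integral_cong inner)
  also have "\<dots> = (\<integral>\<^sup>+y. (\<integral>\<^sup>+x. (\<integral>\<^sup>+u. S (x(?i := y)) * ?c (x(?i := y)) * B (x(?i := y), u) \<partial>?V) \<partial>?X) \<partial>P0)"
  proof (rule X_ins[of "\<lambda>x. \<integral>\<^sup>+u. S x * ?c x * B (x, u) \<partial>?V"])
    show "(\<lambda>x. \<integral>\<^sup>+u. S x * ?c x * B (x, u) \<partial>?V) \<in> borel_measurable ?X'"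
      by (intro VI.borel_measurable_nn_integral) measurable
  qed
  also have "\<dots> = (\<integral>\<^sup>+y. (\<integral>\<^sup>+x. S (x(?i := y)) * ?c (x(?i := y)) \<partial>?X) * (\<Prod>j\<in>?I. emeasure unif01 (A j)) \<partial>P0)"
  proof (rule nn_integral_cong)
    fix y assume y: "y \<in> space P0"
    have upd: "(\<lambda>x. x(?i := y)) \<in> ?X \<rightarrow>\<^sub>M ?X'"
      using y unfolding ins by measurable
    have "(\<integral>\<^sup>+x. (\<integral>\<^sup>+u. S (x(?i := y)) * ?c (x(?i := y)) * B (x, u) \<partial>?V) \<partial>?X)
        = (\<integral>\<^sup>+x. S (x(?i := y)) * ?c (x(?i := y)) \<partial>?X) * (\<Prod>j\<in>?I. emeasure unif01 (A j))"
      unfolding B_def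
    \<comment> \<open>The induction hypothesis is used with a new weight that absorbs
      \<open>?c\<close>. The weight is symmetric in the first \<open>t\<close> observations: such a
      permutation fixes \<open>Suc t\<close>, so it commutes with inserting \<open>y\<close> and
      leaves the rank of the last observation unchanged.\<close>
    proof (rule Suc.IH[of "\<lambda>x. S (x(?i := y)) * ?c (x(?i := y))"]; (intro allI impI ballI)?)
      show "A j \<in> sets unif01" if "j \<in> ?I" for j
        by (rule AI[OF that])
      show "(\<lambda>x. S (x(?i := y)) * ?c (x(?i := y))) \<in> borel_measurable ?X"
        using measurable_compose[OF upd mS] measurable_compose[OF upd mc] by (rule borel_measurable_times_ennreal)
      fix \<pi> x assume \<pi>: "\<pi> permutes ?I" and x: "x \<in> space ?X"
      have \<pi>': "\<pi> permutes {1..Suc t}"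
        by (rule permutes_subset[OF \<pi>]) auto
      have \<pi>i: "\<pi> ?i = ?i"
        by (rule permutes_not_in[OF \<pi>]) auto
      have comp: "(x \<circ> \<pi>)(?i := y) = x(?i := y) \<circ> \<pi>"
      proof
        fix k
        have "\<pi> k = ?i \<longleftrightarrow> k = ?i"
          using \<pi>i permutes_inj[OF \<pi>] by (metis injD)
        then show "((x \<circ> \<pi>)(?i := y)) k = (x(?i := y) \<circ> \<pi>) k"
          by simp
      qed
      note x' = measurable_space[OF upd x]
      show "S ((x \<circ> \<pi>)(?i := y)) * ?c ((x \<circ> \<pi>)(?i := y)) = S (x(?i := y)) * ?c (x(?i := y))"
        unfolding comp sym[OF \<pi>' x'] cond_prob_p_permute[OF \<pi>'] \<pi>i ..
    qed
    then show "(\<integral>\<^sup>+x. (\<integral>\<^sup>+u. S (x(?i := y)) * ?c (x(?i := y)) * B (x(?i := y), u) \<partial>?V) \<partial>?X)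
        = (\<integral>\<^sup>+x. S (x(?i := y)) * ?c (x(?i := y)) \<partial>?X) * (\<Prod>j\<in>?I. emeasure unif01 (A j))"
      unfolding B_last_x .
  qed
  also have "\<dots> = (\<integral>\<^sup>+y. (\<integral>\<^sup>+x. S (x(?i := y)) * ?c (x(?i := y)) \<partial>?X) \<partial>P0) * (\<Prod>j\<in>?I. emeasure unif01 (A j))"
  proof (rule nn_integral_multc)
    have "(\<lambda>(x, y). x(?i := y)) \<in> ?X \<Otimes>\<^sub>M P0 \<rightarrow>\<^sub>M ?X'"
      unfolding ins by (rule measurable_add_dim)
    from measurable_compose[OF measurable_pair_swap' this]
    have upd: "(\<lambda>z. (snd z)(?i := fst z)) \<in> P0 \<Otimes>\<^sub>M ?X \<rightarrow>\<^sub>M ?X'"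
      by (simp add: case_prod_beta)
    have "(\<lambda>z. S ((snd z)(?i := fst z)) * ?c ((snd z)(?i := fst z))) \<in> borel_measurable (P0 \<Otimes>\<^sub>M ?X)"
      using measurable_compose[OF upd mS] measurable_compose[OF upd mc] by (rule borel_measurable_times_ennreal)
    then show "(\<lambda>y. \<integral>\<^sup>+x. S (x(?i := y)) * ?c (x(?i := y)) \<partial>?X) \<in> borel_measurable P0"
      by (intro XI.borel_measurable_nn_integral) (simp add: case_prod_beta)
  qed
  also have "(\<integral>\<^sup>+y. (\<integral>\<^sup>+x. S (x(?i := y)) * ?c (x(?i := y)) \<partial>?X) \<partial>P0) = (\<integral>\<^sup>+x. S x * ?c x \<partial>?X')"
    by (rule X_ins[of "\<lambda>x. S x * ?c x", symmetric]) measurable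
  \<comment> \<open>Only now is the symmetry of \<open>S\<close> in all \<open>Suc t\<close>
    observations used: it lets \<open>?c\<close> be averaged over all ranks and leave the integral
    as the uniform probability of \<open>A (Suc t)\<close>.\<close>
  also have "\<dots> = (\<integral>\<^sup>+x. S x \<partial>?X') * emeasure unif01 (A ?i)"
    by (rule nn_integral_symmetric_cond_prob_p[where S = S and n = ?i and A = "A ?i"])
      (use P0 cont Ai mS sym in auto)
  finally show ?case
    by (simp add: mult_ac)
qed

section \<open>From finite products to the law of a row\<close>

lemma row_law_prob_spaces:
  assumes "real_distribution P0" "real_distribution P1"
  shows "product_prob_space (\<lambda>j::nat. if j \<le> T then P0 else P1)"
    "prob_space (PiM {1..} (\<lambda>j. if j \<le> T then P0 else P1))"
    "prob_space (PiM {1..} (\<lambda>_::nat. unif01))"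
    "prob_space (row_law P0 T P1)"
proof -
  interpret P0: real_distribution P0 by fact
  interpret P1: real_distribution P1 by fact
  show prod: "product_prob_space (\<lambda>j::nat. if j \<le> T then P0 else P1)"
    by (intro product_prob_spaceI) (simp add: P0.prob_space_axioms P1.prob_space_axioms)
  show 1: "prob_space (PiM {1..} (\<lambda>j. if j \<le> T then P0 else P1))"
    by (intro prob_space_PiM) (simp add: P0.prob_space_axioms P1.prob_space_axioms)
  show 2: "prob_space (PiM {1..} (\<lambda>_::nat. unif01))"
    by (intro prob_space_PiM prob_space_unif01)
  show "prob_space (row_law P0 T P1)"
    unfolding row_law_def by (intro prob_space_pair 1 2)
qed

lemma (in product_prob_space) nn_integral_PiM_restrict:
  assumes "finite J" "J \<subseteq> I" "g \<in> borel_measurable (PiM J M)"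
  shows "(\<integral>\<^sup>+x. g (restrict x J) \<partial>PiM I M) = (\<integral>\<^sup>+x. g x \<partial>PiM J M)"
proof -
  have "(\<integral>\<^sup>+x. g x \<partial>PiM J M) = (\<integral>\<^sup>+x. g x \<partial>distr (PiM I M) (PiM J M) (\<lambda>x. restrict x J))"
    by (simp only: distr_PiM_restrict_finite[OF assms(1,2)])
  also have "\<dots> = (\<integral>\<^sup>+x. g (restrict x J) \<partial>PiM I M)"
    using assms by (intro nn_integral_distr measurable_restrict_subset) simp_all
  finally show ?thesis ..
qed

lemma measurable_conformal_p_row_law:
  assumes "real_distribution P0" "real_distribution P1" "1 \<le> j"
  shows "(\<lambda>\<omega>. conformal_p \<omega> j) \<in> row_law P0 T P1 \<rightarrow>\<^sub>M unif01"
  using assms unfolding row_law_def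
  by (intro measurable_conformal_p) (auto simp: real_distribution.events_eq_borel)

text \<open>Product measures are determined by rectangles. The first \<open>T\<close> p-values
  depend only on the first \<open>T\<close> observations and randomizers, so a rectangle is
  evaluated on a finite product of \<open>P0\<close> and uniform laws, where the symmetric identity
  with weight 1 factorizes it.\<close>

lemma distr_conformal_p:
  assumes P0: "real_distribution P0" and P1: "real_distribution P1" and cont: "continuous_on UNIV (cdf P0)"
  shows "distr (row_law P0 T P1) (PiM {1..T} (\<lambda>_. unif01)) (\<lambda>\<omega>. \<lambda>j\<in>{1..T}. conformal_p \<omega> j)
    = PiM {1..T} (\<lambda>_. unif01)"
proof -
  interpret P0: real_distribution P0 by fact
  interpret U: prob_space unif01 by (rule prob_space_unif01)
  interpret V: product_prob_space "\<lambda>_::nat. unif01" "{1..}" by standard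
  interpret X: product_prob_space "\<lambda>j::nat. if j \<le> T then P0 else P1" "{1..}"
    by (rule row_law_prob_spaces[OF P0 P1])
  interpret VT: prob_space "PiM {1..T} (\<lambda>_::nat. unif01)"
    by (rule prob_space_PiM) (rule prob_space_unif01)
  let ?I = "{1..T}" and ?X = "PiM {1..} (\<lambda>j. if j \<le> T then P0 else P1)" and ?V = "PiM {1..} (\<lambda>_::nat. unif01)"
  have XT: "PiM ?I (\<lambda>j. if j \<le> T then P0 else P1) = PiM ?I (\<lambda>_. P0)"
    by (rule PiM_cong) auto
  let ?p = "\<lambda>\<omega>. \<lambda>j\<in>?I. conformal_p \<omega> j"
  have p: "?p \<in> row_law P0 T P1 \<rightarrow>\<^sub>M PiM ?I (\<lambda>_. unif01)"
    by (intro measurable_restrict measurable_conformal_p_row_law P0 P1) auto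
  show ?thesis
  proof (rule V.PiM_eqI)
    fix A assume A: "\<And>j. j \<in> ?I \<Longrightarrow> A j \<in> sets unif01"
    define B where "B \<omega> = (\<Prod>j\<in>?I. indicator (A j) (conformal_p \<omega> j) :: ennreal)" for \<omega>
    have mB: "B \<in> borel_measurable (PiM ?I (\<lambda>_. P0) \<Otimes>\<^sub>M PiM ?I (\<lambda>_. unif01))"
      unfolding B_def by (rule borel_measurable_prod_conformal_p[OF A]; simp)
    have mB_row: "B \<in> borel_measurable (row_law P0 T P1)"
      unfolding B_def
    proof (intro borel_measurable_prod_ennreal)
      fix j assume j: "j \<in> ?I"
      then have "(\<lambda>\<omega>. conformal_p \<omega> j) \<in> row_law P0 T P1 \<rightarrow>\<^sub>M unif01"
        by (intro measurable_conformal_p_row_law P0 P1) auto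
      from measurable_compose[OF this borel_measurable_indicator[OF A[OF j]]]
      show "(\<lambda>\<omega>. indicator (A j) (conformal_p \<omega> j) :: ennreal) \<in> borel_measurable (row_law P0 T P1)" .
    qed
    have B_restrict: "B (x, u) = B (restrict x ?I, restrict u ?I)" for x u
      unfolding B_def by (intro prod.cong refl arg_cong2[where f = indicator] conformal_p_cong) auto
    have PA: "Pi\<^sub>E ?I A \<in> sets (PiM ?I (\<lambda>_. unif01))"
      using A by (intro sets_PiM_I_finite) auto
    have "emeasure (distr (row_law P0 T P1) (PiM ?I (\<lambda>_. unif01)) ?p) (Pi\<^sub>E ?I A)
        = (\<integral>\<^sup>+z. indicator (Pi\<^sub>E ?I A) z \<partial>distr (row_law P0 T P1) (PiM ?I (\<lambda>_. unif01)) ?p)"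
      using PA by simp
    also have "\<dots> = (\<integral>\<^sup>+\<omega>. indicator (Pi\<^sub>E ?I A) (?p \<omega>) \<partial>row_law P0 T P1)"
      using p PA by (intro nn_integral_distr) simp_all
    also have "\<dots> = (\<integral>\<^sup>+\<omega>. B \<omega> \<partial>row_law P0 T P1)"
      by (intro nn_integral_cong) (auto simp: B_def indicator_def prod_zero_iff Pi_iff intro!: prod.neutral[symmetric])
    also have "\<dots> = (\<integral>\<^sup>+x. (\<integral>\<^sup>+u. B (x, u) \<partial>?V) \<partial>?X)"
      using mB_row unfolding row_law_def by (rule V.P.nn_integral_fst[symmetric])
    also have "\<dots> = (\<integral>\<^sup>+x. (\<integral>\<^sup>+u. B (restrict x ?I, restrict u ?I) \<partial>?V) \<partial>?X)"
      by (simp only: B_restrict[symmetric])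
    also have "\<dots> = (\<integral>\<^sup>+x. (\<integral>\<^sup>+u. B (restrict x ?I, u) \<partial>PiM ?I (\<lambda>_. unif01)) \<partial>?X)"
    proof (rule nn_integral_cong)
      fix x assume "x \<in> space ?X"
      then have "restrict x ?I \<in> space (PiM ?I (\<lambda>_. P0))"
        by (auto simp: space_PiM PiE_def Pi_def)
      from measurable_compose[OF measurable_Pair1'[OF this] mB]
      show "(\<integral>\<^sup>+u. B (restrict x ?I, restrict u ?I) \<partial>?V) = (\<integral>\<^sup>+u. B (restrict x ?I, u) \<partial>PiM ?I (\<lambda>_. unif01))"
        by (intro V.nn_integral_PiM_restrict[where g = "\<lambda>u. B (restrict x ?I, u)"]) auto
    qed
    also have "\<dots> = (\<integral>\<^sup>+x. (\<integral>\<^sup>+u. B (x, u) \<partial>PiM ?I (\<lambda>_. unif01)) \<partial>PiM ?I (\<lambda>_. P0))"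
      unfolding XT[symmetric]
      using VT.borel_measurable_nn_integral_fst[OF mB]
      by (intro X.nn_integral_PiM_restrict[where g = "\<lambda>x. \<integral>\<^sup>+u. B (x, u) \<partial>PiM ?I (\<lambda>_. unif01)"])
        (auto simp: XT simp del: One_nat_def)
    also have "\<dots> = (\<integral>\<^sup>+x. (\<integral>\<^sup>+u. 1 * B (x, u) \<partial>PiM ?I (\<lambda>_. unif01)) \<partial>PiM ?I (\<lambda>_. P0))"
      by simp
    also have "\<dots> = (\<integral>\<^sup>+x. 1 \<partial>PiM ?I (\<lambda>_. P0)) * (\<Prod>j\<in>?I. emeasure unif01 (A j))"
      unfolding B_def using A
      by (intro nn_integral_symmetric_conformal_p[OF P0 cont]) auto
    also have "(\<integral>\<^sup>+x. 1 \<partial>PiM ?I (\<lambda>_. P0)) = 1"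
      using prob_space.emeasure_space_1[OF prob_space_PiM[of ?I "\<lambda>_. P0"]] P0.prob_space_axioms by simp
    finally show "emeasure (distr (row_law P0 T P1) (PiM ?I (\<lambda>_. unif01)) ?p) (Pi\<^sub>E ?I A)
        = (\<Prod>j\<in>?I. emeasure unif01 (A j))"
      by (simp only: mult_1)
  qed simp_all
qed

subsection \<open>A maximal inequality for the sum statistic\<close>

locale detector = prob_space \<mu> for \<mu> :: "'p measure" +
  fixes f :: "'p \<Rightarrow> real \<Rightarrow> real"
  assumes f_meas: "case_prod f \<in> borel_measurable (\<mu> \<Otimes>\<^sub>M restrict_space borel {0..1})"
    and f_density: "\<And>\<theta>. \<theta> \<in> space \<mu> \<Longrightarrow> (\<integral>\<^sup>+x. ennreal (f \<theta> x) \<partial>unif01) = 1"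
begin

lemma f_meas_unif01: "case_prod f \<in> borel_measurable (\<mu> \<Otimes>\<^sub>M unif01)"
  using f_meas by (simp cong: measurable_cong_sets sets_pair_measure_cong add: sets_unif01[symmetric])

text \<open>The process \<open>p\<close> is arbitrary because the statistics are evaluated both on
  conformal p-values of a row and on the coordinates of a product of uniform laws.\<close>

lemma borel_measurable_prod_density:
  assumes "\<And>j. j \<in> {k..t} \<Longrightarrow> (\<lambda>\<omega>. p \<omega> j) \<in> N \<rightarrow>\<^sub>M unif01"
  shows "(\<lambda>(\<omega>, \<theta>). \<Prod>j=k..t. ennreal (f \<theta> (p \<omega> j))) \<in> borel_measurable (N \<Otimes>\<^sub>M \<mu>)"
proof -
  have "(\<lambda>z. ennreal (f (snd z) (p (fst z) j))) \<in> borel_measurable (N \<Otimes>\<^sub>M \<mu>)" if "j \<in> {k..t}" for j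
  proof -
    note [measurable] = assms[OF that]
    have "(\<lambda>z. (snd z, p (fst z) j)) \<in> N \<Otimes>\<^sub>M \<mu> \<rightarrow>\<^sub>M \<mu> \<Otimes>\<^sub>M unif01"
      by measurable
    from measurable_compose[OF this f_meas_unif01] show ?thesis
      by simp
  qed
  then show ?thesis
    by (simp add: case_prod_beta borel_measurable_prod_ennreal)
qed

lemma borel_measurable_mixture:
  assumes "\<And>j. j \<in> {k..t} \<Longrightarrow> (\<lambda>\<omega>. p \<omega> j) \<in> N \<rightarrow>\<^sub>M unif01"
  shows "(\<lambda>\<omega>. mixture \<mu> f (p \<omega>) k t) \<in> borel_measurable N"
  unfolding mixture_def
  using borel_measurable_nn_integral[OF borel_measurable_prod_density[OF assms]] by simp

lemma mixture_cong:
  assumes "\<And>j. j \<in> {k..t} \<Longrightarrow> z j = z' j"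
  shows "mixture \<mu> f z k t = mixture \<mu> f z' k t"
  unfolding mixture_def by (intro nn_integral_cong prod.cong) (auto simp: assms)

text \<open>By Tonelli the fresh coordinate is integrated before \<theta>, and each density
  integrates to 1: the mixture is a martingale under uniform p-values. The case
  \<open>k = Suc t\<close> is included; its right side is a mixture of empty products.\<close>

lemma nn_integral_mixture_Suc:
  assumes k: "k \<le> Suc t" and z: "\<And>j. j \<in> {k..t} \<Longrightarrow> z j \<in> {0..1}"
  shows "(\<integral>\<^sup>+y. mixture \<mu> f (z(Suc t := y)) k (Suc t) \<partial>unif01) = mixture \<mu> f z k t"
proof -
  interpret U: prob_space unif01 by (rule prob_space_unif01)
  interpret pair_sigma_finite \<mu> unif01 ..
  define g where "g \<theta> = (\<Prod>j=k..t. ennreal (f \<theta> (z j)))" for \<theta>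
  have prod: "(\<Prod>j=k..Suc t. ennreal (f \<theta> ((z(Suc t := y)) j))) = g \<theta> * ennreal (f \<theta> y)" for \<theta> y
    using k by (simp add: prod.cl_ivl_Suc g_def)
  have fj: "(\<lambda>\<theta>. ennreal (f \<theta> (z j))) \<in> borel_measurable \<mu>" if "j \<in> {k..t}" for j
    using measurable_compose[OF measurable_Pair2'[of "z j" unif01 \<mu>] f_meas_unif01] z[OF that] by simp
  have g [measurable]: "g \<in> borel_measurable \<mu>"
    unfolding g_def by (intro borel_measurable_prod_ennreal fj)
  note [measurable] = f_meas_unif01
  have fy: "(\<lambda>y. ennreal (f \<theta> y)) \<in> borel_measurable unif01" if "\<theta> \<in> space \<mu>" for \<theta>
    using measurable_compose[OF measurable_Pair1'[OF that] f_meas_unif01] by simp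
  have "(\<integral>\<^sup>+y. mixture \<mu> f (z(Suc t := y)) k (Suc t) \<partial>unif01) = (\<integral>\<^sup>+y. (\<integral>\<^sup>+\<theta>. g \<theta> * ennreal (f \<theta> y) \<partial>\<mu>) \<partial>unif01)"
    unfolding mixture_def prod ..
  also have "\<dots> = (\<integral>\<^sup>+\<theta>. (\<integral>\<^sup>+y. g \<theta> * ennreal (f \<theta> y) \<partial>unif01) \<partial>\<mu>)"
    by (rule Fubini') measurable
  also have "\<dots> = (\<integral>\<^sup>+\<theta>. g \<theta> \<partial>\<mu>)"
    by (intro nn_integral_cong) (simp add: nn_integral_cmult fy f_density)
  finally show ?thesis
    by (simp add: mixture_def g_def)
qed

text \<open>The sum statistic detached from the sample point, as a weighted Shiryaev-Roberts
  statistic of any sequence of p-values, so that it can be studied under the product of uniform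
  laws.\<close>

definition shiryaev_roberts :: "(nat \<Rightarrow> real) \<Rightarrow> (nat \<Rightarrow> real) \<Rightarrow> nat \<Rightarrow> ennreal" where
  "shiryaev_roberts w z t = (\<Sum>k=1..t. ennreal (w k) * mixture \<mu> f z k t)"

lemma borel_measurable_shiryaev_roberts:
  assumes "\<And>j. j \<in> {1..t} \<Longrightarrow> (\<lambda>\<omega>. p \<omega> j) \<in> N \<rightarrow>\<^sub>M unif01"
  shows "(\<lambda>\<omega>. shiryaev_roberts w (p \<omega>) t) \<in> borel_measurable N"
  unfolding shiryaev_roberts_def
  by (intro borel_measurable_sum borel_measurable_times_ennreal borel_measurable_mixture borel_measurable_const assms) auto

lemma shiryaev_roberts_cong:
  assumes "\<And>j. j \<in> {1..t} \<Longrightarrow> z j = z' j"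
  shows "shiryaev_roberts w z t = shiryaev_roberts w z' t"
  unfolding shiryaev_roberts_def
  by (intro sum.cong refl arg_cong2[where f = times] mixture_cong) (auto simp: assms)

lemma mixture_Suc_self [simp]: "mixture \<mu> f z (Suc t) t = 1"
  by (simp add: mixture_def emeasure_space_1)

text \<open>Every earlier start keeps its value in the mean, while the start
  \<open>k = Suc t\<close> joins with an empty past, hence with mixture 1. Its weight is the entire
  drift.\<close>

lemma nn_integral_shiryaev_roberts_Suc:
  assumes z: "\<And>j. j \<in> {1..t} \<Longrightarrow> z j \<in> {0..1}"
  shows "(\<integral>\<^sup>+y. shiryaev_roberts w (z(Suc t := y)) (Suc t) \<partial>unif01)
    = shiryaev_roberts w z t + ennreal (w (Suc t))"
proof -
  have m: "(\<lambda>y. mixture \<mu> f (z(Suc t := y)) k (Suc t)) \<in> borel_measurable unif01" if "k \<in> {1..Suc t}" for k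
  proof (rule borel_measurable_mixture)
    fix j assume "j \<in> {k..Suc t}"
    then show "(\<lambda>y. (z(Suc t := y)) j) \<in> unif01 \<rightarrow>\<^sub>M unif01"
      using z[of j] that by (cases "j = Suc t") auto
  qed
  have "(\<integral>\<^sup>+y. shiryaev_roberts w (z(Suc t := y)) (Suc t) \<partial>unif01)
      = (\<Sum>k=1..Suc t. \<integral>\<^sup>+y. ennreal (w k) * mixture \<mu> f (z(Suc t := y)) k (Suc t) \<partial>unif01)"
    unfolding shiryaev_roberts_def
    by (intro nn_integral_sum borel_measurable_times_ennreal borel_measurable_const m)
  also have "\<dots> = (\<Sum>k=1..Suc t. ennreal (w k) * mixture \<mu> f z k t)"
  proof (rule sum.cong[OF refl])
    fix k assume k: "k \<in> {1..Suc t}"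
    have "(\<integral>\<^sup>+y. mixture \<mu> f (z(Suc t := y)) k (Suc t) \<partial>unif01) = mixture \<mu> f z k t"
      using k z by (intro nn_integral_mixture_Suc) auto
    then show "(\<integral>\<^sup>+y. ennreal (w k) * mixture \<mu> f (z(Suc t := y)) k (Suc t) \<partial>unif01)
      = ennreal (w k) * mixture \<mu> f z k t"
      by (simp only: nn_integral_cmult[OF m[OF k]])
  qed
  also have "\<dots> = shiryaev_roberts w z t + ennreal (w (Suc t))"
    by (simp add: shiryaev_roberts_def)
  finally show ?thesis .
qed

text \<open>Counting the statistic as \<open>b\<close> from its first crossing on takes the place of optional stopping.\<close>

lemma nn_integral_stopped_shiryaev_roberts:
  "(\<integral>\<^sup>+z. (if \<exists>s\<in>{1..t}. b \<le> shiryaev_roberts w z s then b else shiryaev_roberts w z t) \<partial>PiM {1..t} (\<lambda>_. unif01))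
    \<le> (\<Sum>k=1..t. ennreal (w k))"
proof (induction t)
  case 0
  have "{1..0::nat} = {}"
    by simp
  then show ?case
    by (simp add: shiryaev_roberts_def)
next
  case (Suc t)
  interpret U: prob_space unif01 by (rule prob_space_unif01)
  interpret V: product_prob_space "\<lambda>_::nat. unif01" by standard
  interpret VI: prob_space "PiM {1..t} (\<lambda>_. unif01)" by (rule prob_space_PiM) (rule prob_space_unif01)
  define E where "E t z \<longleftrightarrow> (\<exists>s\<in>{1..t}. b \<le> shiryaev_roberts w z s)" for t z
  define v where "v t z = (if E t z then b else shiryaev_roberts w z t)" for t z
  have SR: "(\<lambda>z. shiryaev_roberts w z s) \<in> borel_measurable (PiM {1..t} (\<lambda>_. unif01))" if "s \<le> t" for s t
    by (rule borel_measurable_shiryaev_roberts) (use that in auto)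
  have v: "v t \<in> borel_measurable (PiM {1..t} (\<lambda>_. unif01))" for t
  proof -
    have "Measurable.pred (PiM {1..t} (\<lambda>_. unif01)) (\<lambda>z. b \<le> shiryaev_roberts w z s)" if "s \<in> {1..t}" for s
      using SR[of s t] that by (intro borel_measurable_le[THEN pred_def[THEN iffD2]]) auto
    then have [measurable]: "Measurable.pred (PiM {1..t} (\<lambda>_. unif01)) (E t)"
      unfolding E_def by (intro pred_intros_finite) auto
    note [measurable] = SR[OF order_refl, of t]
    show ?thesis
      unfolding v_def by measurable
  qed
  have ins: "{1..Suc t} = insert (Suc t) {1..t}"
    by auto
  have "(\<integral>\<^sup>+z. v (Suc t) z \<partial>PiM {1..Suc t} (\<lambda>_. unif01))
      = (\<integral>\<^sup>+z. (\<integral>\<^sup>+y. v (Suc t) (z(Suc t := y)) \<partial>unif01) \<partial>PiM {1..t} (\<lambda>_. unif01))"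
    using v[of "Suc t"] unfolding ins by (intro V.product_nn_integral_insert) auto
  also have "\<dots> \<le> (\<integral>\<^sup>+z. v t z + ennreal (w (Suc t)) \<partial>PiM {1..t} (\<lambda>_. unif01))"
  proof (rule nn_integral_mono)
    fix z assume "z \<in> space (PiM {1..t} (\<lambda>_. unif01))"
    then have z: "z j \<in> {0..1}" if "j \<in> {1..t}" for j
      using that by (auto simp: space_PiM PiE_def Pi_def)
    have upd: "shiryaev_roberts w (z(Suc t := y)) s = shiryaev_roberts w z s" if "s \<le> t" for s y
      using that by (intro shiryaev_roberts_cong) auto
    show "(\<integral>\<^sup>+y. v (Suc t) (z(Suc t := y)) \<partial>unif01) \<le> v t z + ennreal (w (Suc t))"
    proof (cases "E t z")
      case True
      \<comment> \<open>A crossing by time \<open>t\<close> does not see the fresh coordinate, so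
        the stopped value remains \<open>b\<close>.\<close>
      then have "E (Suc t) (z(Suc t := y))" for y
        unfolding E_def using upd by (metis atLeastAtMost_iff le_Suc_eq)
      then show ?thesis
        using True by (simp add: v_def U.emeasure_space_1[simplified])
    next
      case False
      \<comment> \<open>Without an earlier crossing the stopped value at \<open>Suc t\<close> is the
        statistic itself or, at a first crossing, the threshold \<open>b\<close>, which is then no
        larger.\<close>
      have "(\<integral>\<^sup>+y. v (Suc t) (z(Suc t := y)) \<partial>unif01) \<le> (\<integral>\<^sup>+y. shiryaev_roberts w (z(Suc t := y)) (Suc t) \<partial>unif01)"
      proof (rule nn_integral_mono)
        fix y
        show "v (Suc t) (z(Suc t := y)) \<le> shiryaev_roberts w (z(Suc t := y)) (Suc t)"
          using False upd unfolding v_def E_def by (auto simp: le_Suc_eq)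
      qed
      also have "\<dots> = v t z + ennreal (w (Suc t))"
        using nn_integral_shiryaev_roberts_Suc[OF z] False by (simp only: v_def if_False)
      finally show ?thesis .
    qed
  qed
  also have "\<dots> = (\<integral>\<^sup>+z. v t z \<partial>PiM {1..t} (\<lambda>_. unif01)) + ennreal (w (Suc t))"
    using v[of t] by (simp add: nn_integral_add VI.emeasure_space_1 del: One_nat_def)
  also have "\<dots> \<le> (\<Sum>k=1..Suc t. ennreal (w k))"
    using Suc.IH by (simp add: v_def E_def add_right_mono del: One_nat_def)
  finally show ?case
    by (simp add: v_def E_def)
qed

text \<open>On the crossing event the stopped statistic equals \<open>b\<close>, and elsewhere it is
  nonnegative, so its integral is at least \<open>b\<close> times the probability of
  crossing.\<close>

lemma emeasure_shiryaev_roberts_crossing: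
  "b * emeasure (PiM {1..t} (\<lambda>_. unif01)) {z \<in> space (PiM {1..t} (\<lambda>_. unif01)). \<exists>s\<in>{1..t}. b \<le> shiryaev_roberts w z s}
    \<le> (\<Sum>k=1..t. ennreal (w k))"
proof -
  let ?N = "PiM {1..t} (\<lambda>_. unif01)"
  let ?E = "{z \<in> space ?N. \<exists>s\<in>{1..t}. b \<le> shiryaev_roberts w z s}"
  have SR: "(\<lambda>z. shiryaev_roberts w z s) \<in> borel_measurable ?N" if "s \<in> {1..t}" for s
    by (rule borel_measurable_shiryaev_roberts) (use that in auto)
  have "?E \<in> sets ?N"
    by (intro sets.sets_Collect_finite_Ex borel_measurable_le SR) auto
  then have "b * emeasure ?N ?E = (\<integral>\<^sup>+z. b * indicator ?E z \<partial>?N)"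
    by (simp add: nn_integral_cmult)
  also have "\<dots> \<le> (\<integral>\<^sup>+z. (if \<exists>s\<in>{1..t}. b \<le> shiryaev_roberts w z s then b else shiryaev_roberts w z t) \<partial>?N)"
    by (intro nn_integral_mono) (auto simp: indicator_def)
  also note nn_integral_stopped_shiryaev_roberts
  finally show ?thesis .
qed

end

subsection \<open>Mean deviation of the log-likelihood after the change\<close>

text \<open>Variances of independent centred terms add: integrating one new coordinate kills its
  cross term with the previous sum, and its own square contributes at most
  \<open>C\<^sup>2\<close>.\<close>

lemma (in product_prob_space) nn_integral_square_sum_PiM:
  assumes J: "finite J"
    and g: "\<And>i. i \<in> J \<Longrightarrow> g i \<in> borel_measurable (M i)"
    and bound: "\<And>i x. i \<in> J \<Longrightarrow> x \<in> space (M i) \<Longrightarrow> \<bar>g i x\<bar> \<le> C"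
    and centred: "\<And>i. i \<in> J \<Longrightarrow> (\<integral>x. g i x \<partial>M i) = 0"
  shows "(\<integral>\<^sup>+x. ennreal ((\<Sum>i\<in>J. g i (x i))\<^sup>2) \<partial>PiM J M) \<le> ennreal (real (card J) * C\<^sup>2)"
  using assms
proof (induction J)
  case empty
  then show ?case
    by simp
next
  case (insert i J)
  interpret PJ: prob_space "PiM J M"
    by (rule prob_space_PiM) (rule prob_space)
  have S: "(\<lambda>x. \<Sum>k\<in>J'. g k (x k)) \<in> borel_measurable (PiM J' M)" if "J' \<subseteq> insert i J" for J'
  proof (rule borel_measurable_sum)
    fix k assume k: "k \<in> J'"
    show "(\<lambda>x. g k (x k)) \<in> borel_measurable (PiM J' M)"
      by (rule measurable_compose[OF measurable_component_singleton[OF k, of M] insert.prems(1)]) (use k that in auto)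
  qed
  have gi: "integrable (M i) (g i)"
    using insert.prems by (intro M.integrable_const_bound[where B = C]) auto
  have gi2: "integrable (M i) (\<lambda>y. (g i y)\<^sup>2)"
    using insert.prems
    by (intro M.integrable_const_bound[where B = "C\<^sup>2"] AE_I2) (auto simp: abs_le_square_iff[symmetric] intro!: power_mono order_trans[OF _ abs_ge_self])
  have gi2_le: "(\<integral>y. (g i y)\<^sup>2 \<partial>M i) \<le> C\<^sup>2"
    using insert.prems(2)[of i] M.prob_space
    by (intro M.integral_le_const[OF gi2] AE_I2) (auto simp: abs_le_square_iff[symmetric] intro: order_trans[OF _ abs_ge_self])
  have "(\<integral>\<^sup>+x. ennreal ((\<Sum>k\<in>insert i J. g k (x k))\<^sup>2) \<partial>PiM (insert i J) M)
      = (\<integral>\<^sup>+x. (\<integral>\<^sup>+y. ennreal ((\<Sum>k\<in>insert i J. g k ((x(i := y)) k))\<^sup>2) \<partial>M i) \<partial>PiM J M)"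
    by (intro product_nn_integral_insert insert.hyps measurable_compose[OF borel_measurable_power[OF S] measurable_ennreal]) auto
  also have "\<dots> = (\<integral>\<^sup>+x. (\<integral>\<^sup>+y. ennreal (((\<Sum>k\<in>J. g k (x k)) + g i y)\<^sup>2) \<partial>M i) \<partial>PiM J M)"
  proof -
    have "(\<Sum>k\<in>insert i J. g k ((x(i := y)) k)) = (\<Sum>k\<in>J. g k (x k)) + g i y" for x y
      using insert.hyps by (auto simp: add.commute intro!: sum.cong)
    then show ?thesis
      by simp
  qed
  also have "\<dots> \<le> (\<integral>\<^sup>+x. ennreal ((\<Sum>k\<in>J. g k (x k))\<^sup>2) + ennreal (C\<^sup>2) \<partial>PiM J M)"
  proof (rule nn_integral_mono)
    fix x
    let ?s = "\<Sum>k\<in>J. g k (x k)"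
    have "(\<integral>\<^sup>+y. ennreal ((?s + g i y)\<^sup>2) \<partial>M i) = ennreal (\<integral>y. (?s + g i y)\<^sup>2 \<partial>M i)"
    proof (rule nn_integral_eq_integral)
      show "integrable (M i) (\<lambda>y. (?s + g i y)\<^sup>2)"
        using gi gi2 by (simp add: power2_sum)
    qed simp
    also have "(\<integral>y. (?s + g i y)\<^sup>2 \<partial>M i) = ?s\<^sup>2 + (\<integral>y. (g i y)\<^sup>2 \<partial>M i)"
      using gi gi2 insert.prems(3)[of i] by (simp add: power2_sum M.prob_space)
    also have "\<dots> \<le> ?s\<^sup>2 + C\<^sup>2"
      using gi2_le by simp
    finally show "(\<integral>\<^sup>+y. ennreal ((?s + g i y)\<^sup>2) \<partial>M i) \<le> ennreal (?s\<^sup>2) + ennreal (C\<^sup>2)"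
      by (simp add: ennreal_plus[symmetric] ennreal_leI del: ennreal_plus)
  qed
  also have "\<dots> = (\<integral>\<^sup>+x. ennreal ((\<Sum>k\<in>J. g k (x k))\<^sup>2) \<partial>PiM J M) + ennreal (C\<^sup>2)"
    using borel_measurable_power[OF S[OF subset_insertI], of 2]
    by (subst nn_integral_add) (auto simp: PJ.emeasure_space_1)
  also have "\<dots> \<le> ennreal (real (card J) * C\<^sup>2) + ennreal (C\<^sup>2)"
    using insert.prems by (intro add_right_mono insert.IH) auto
  also have "\<dots> = ennreal (real (card (insert i J)) * C\<^sup>2)"
    using insert.hyps by (simp add: ennreal_plus[symmetric] algebra_simps del: ennreal_plus)
  finally show ?case .
qed

text \<open>Instead of Cauchy-Schwarz, the pointwise bound by
  \<open>z\<^sup>2 / (2 * s) + s / 2\<close> reduces the first moment to the second. Taking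
  \<open>s\<close> as the square root of the number of terms gives both parts that order, at the
  price of the constant \<open>(C\<^sup>2 + 1) / 2\<close> in place of \<open>C\<close>.\<close>

lemma (in product_prob_space) nn_integral_abs_sum_PiM:
  assumes J: "finite J" "J \<noteq> {}"
    and g: "\<And>i. i \<in> J \<Longrightarrow> g i \<in> borel_measurable (M i)"
    and bound: "\<And>i x. i \<in> J \<Longrightarrow> x \<in> space (M i) \<Longrightarrow> \<bar>g i x\<bar> \<le> C"
    and centred: "\<And>i. i \<in> J \<Longrightarrow> (\<integral>x. g i x \<partial>M i) = 0"
  shows "(\<integral>\<^sup>+x. ennreal \<bar>\<Sum>i\<in>J. g i (x i)\<bar> \<partial>PiM J M) \<le> ennreal (sqrt (card J) * ((C\<^sup>2 + 1) / 2))"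
proof -
  interpret PJ: prob_space "PiM J M"
    by (rule prob_space_PiM) (rule prob_space)
  define s where "s = sqrt (card J)"
  have s: "0 < s" "s\<^sup>2 = card J"
    using J by (auto simp: s_def card_gt_0_iff)
  have [measurable]: "(\<lambda>x. \<Sum>k\<in>J. g k (x k)) \<in> borel_measurable (PiM J M)"
  proof (rule borel_measurable_sum)
    fix k assume k: "k \<in> J"
    show "(\<lambda>x. g k (x k)) \<in> borel_measurable (PiM J M)"
      by (rule measurable_compose[OF measurable_component_singleton[OF k, of M] g[OF k]])
  qed
  have amgm: "\<bar>z\<bar> \<le> 1 / (2 * s) * z\<^sup>2 + s / 2" for z
  proof -
    have "0 \<le> (\<bar>z\<bar> - s)\<^sup>2"
      by simp
    then have "2 * s * \<bar>z\<bar> \<le> z\<^sup>2 + s\<^sup>2"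
      by (simp add: power2_diff algebra_simps)
    then show ?thesis
      using s(1) by (simp add: field_simps power2_eq_square)
  qed
  have "(\<integral>\<^sup>+x. ennreal \<bar>\<Sum>i\<in>J. g i (x i)\<bar> \<partial>PiM J M)
      \<le> (\<integral>\<^sup>+x. ennreal (1 / (2 * s)) * ennreal ((\<Sum>i\<in>J. g i (x i))\<^sup>2) + ennreal (s / 2) \<partial>PiM J M)"
    using s(1) amgm
    by (intro nn_integral_mono) (simp add: ennreal_mult[symmetric] ennreal_plus[symmetric] ennreal_leI del: ennreal_plus)
  also have "\<dots> = ennreal (1 / (2 * s)) * (\<integral>\<^sup>+x. ennreal ((\<Sum>i\<in>J. g i (x i))\<^sup>2) \<partial>PiM J M) + ennreal (s / 2)"
    by (simp add: nn_integral_add nn_integral_cmult PJ.emeasure_space_1)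
  also have "\<dots> \<le> ennreal (1 / (2 * s)) * ennreal (real (card J) * C\<^sup>2) + ennreal (s / 2)"
    by (intro add_right_mono mult_left_mono nn_integral_square_sum_PiM J g bound centred) auto
  also have "\<dots> = ennreal (1 / (2 * s) * (s\<^sup>2 * C\<^sup>2) + s / 2)"
    using s by (simp add: ennreal_mult[symmetric] ennreal_plus[symmetric] del: ennreal_plus)
  also have "1 / (2 * s) * (s\<^sup>2 * C\<^sup>2) + s / 2 = s * ((C\<^sup>2 + 1) / 2)"
    using s(1) by (simp add: field_simps power2_eq_square)
  finally show ?thesis
    by (simp add: s_def)
qed

lemma (in real_distribution) cdf_bounds: "cdf M x \<in> {0..1}"
  by (simp add: cdf_nonneg cdf_bounded_prob)

lemma (in real_distribution) borel_measurable_cdf: "cdf M \<in> borel_measurable borel"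
  by (intro borel_measurable_mono monoI cdf_nondecreasing)

section \<open>Comparison of the p-values after the change with the CDF of \<open>P0\<close>\<close>

lemma nn_integral_row_law_fst:
  assumes P: "real_distribution P0" "real_distribution P1" and J: "finite J" "J \<subseteq> {1..}"
    and g: "g \<in> borel_measurable (PiM J (\<lambda>j. if j \<le> T then P0 else P1))"
  shows "(\<integral>\<^sup>+\<omega>. g (restrict (fst \<omega>) J) \<partial>row_law P0 T P1)
    = (\<integral>\<^sup>+x. g x \<partial>PiM J (\<lambda>j. if j \<le> T then P0 else P1))"
proof -
  interpret X: product_prob_space "\<lambda>j::nat. if j \<le> T then P0 else P1" "{1..}"
    by (rule row_law_prob_spaces[OF P])
  interpret V: prob_space "PiM {1..} (\<lambda>_::nat. unif01)"
    by (rule row_law_prob_spaces[OF P])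
  have m: "(\<lambda>x. g (restrict x J)) \<in> borel_measurable (PiM {1..} (\<lambda>j. if j \<le> T then P0 else P1))"
    by (rule measurable_compose[OF measurable_restrict_subset g]) (rule J)
  have "(\<integral>\<^sup>+\<omega>. g (restrict (fst \<omega>) J) \<partial>row_law P0 T P1)
      = (\<integral>\<^sup>+x. g (restrict x J) \<partial>PiM {1..} (\<lambda>j. if j \<le> T then P0 else P1))"
    unfolding row_law_def
    using V.nn_integral_fst[OF measurable_compose[OF measurable_fst m]] by (simp add: V.emeasure_space_1 del: One_nat_def)
  also have "\<dots> = (\<integral>\<^sup>+x. g x \<partial>PiM J (\<lambda>j. if j \<le> T then P0 else P1))"
    by (rule X.nn_integral_PiM_restrict[OF J g])
  finally show ?thesis .
qed

lemma nn_integral_empirical_measure: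
  assumes P0: "real_distribution P0" and T: "1 \<le> T" and A: "A \<in> sets borel"
  shows "(\<integral>\<^sup>+x. ennreal \<bar>(\<Sum>i=1..T. of_bool (x i \<in> A)) - real T * measure P0 A\<bar> \<partial>PiM {1..T} (\<lambda>_. P0))
    \<le> ennreal (sqrt (real T))"
proof -
  interpret P0: real_distribution P0 by fact
  interpret X: product_prob_space "\<lambda>_::nat. P0" "{1..T}" by standard
  let ?g = "\<lambda>(i::nat) x. indicator A x - measure P0 A :: real"
  have "(\<integral>\<^sup>+x. ennreal \<bar>(\<Sum>i=1..T. of_bool (x i \<in> A)) - real T * measure P0 A\<bar> \<partial>PiM {1..T} (\<lambda>_. P0))
      = (\<integral>\<^sup>+x. ennreal \<bar>\<Sum>i=1..T. ?g i (x i)\<bar> \<partial>PiM {1..T} (\<lambda>_. P0))"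
    by (simp add: sum_subtractf indicator_def of_bool_def)
  \<comment> \<open>Centred indicators are bounded by \<open>C = 1\<close>, for which the factor
    \<open>(C\<^sup>2 + 1) / 2\<close> is 1.\<close>
  also have "\<dots> \<le> ennreal (sqrt (card {1..T}) * ((1\<^sup>2 + 1) / 2))"
  proof (rule X.nn_integral_abs_sum_PiM)
    show "\<bar>?g i x\<bar> \<le> 1" for i x
      by (auto simp: indicator_def abs_le_iff intro: order_trans[OF P0.prob_le_1] order_trans[OF _ measure_nonneg])
    show "(\<integral>x. ?g i x \<partial>P0) = 0" for i
      using A P0.prob_space
      by (subst Bochner_Integration.integral_diff) (auto simp: P0.emeasure_eq_measure)
  qed (use T A in auto)
  finally show ?thesis
    by simp
qed

text \<open>Each summand of the randomized rank lies between the indicators of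
  \<open>x i < x j\<close> and \<open>x i \<le> x j\<close>, so the part up to \<open>T\<close> is
  squeezed between the two empirical counts. The other \<open>j - T\<close> summands lie in the unit
  interval, as does \<open>F\<close>, and cost at most \<open>j - T\<close> in total.\<close>

lemma conformal_p_deviation:
  assumes T: "T < j" and u: "u j \<in> {0..1}" and F: "F \<in> {0..1}"
  shows "real j * \<bar>conformal_p (x, u) j - F\<bar>
    \<le> \<bar>(\<Sum>i=1..T. of_bool (x i < x j)) - real T * F\<bar> + \<bar>(\<Sum>i=1..T. of_bool (x i \<le> x j)) - real T * F\<bar>
      + (real j - real T)"
proof -
  define n where "n i = of_bool (x i < x j) + u j * of_bool (x i = x j)" for i
  define A B where "A = (\<Sum>i=1..T. of_bool (x i < x j) :: real)" and "B = (\<Sum>i=1..T. of_bool (x i \<le> x j) :: real)"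
  have n: "0 \<le> n i" "n i \<le> 1" "of_bool (x i < x j) \<le> n i" "n i \<le> of_bool (x i \<le> x j)" for i
    using u by (auto simp: n_def of_bool_def)
  have "real j * conformal_p (x, u) j = (\<Sum>i=1..j. n i)"
    using T by (simp add: conformal_p_def n_def sum.distrib sum_distrib_left)
  also have "\<dots> = (\<Sum>i=1..T. n i) + (\<Sum>i=T+1..j. n i)"
    using T sum.ub_add_nat[of 1 T n "j - T"] by simp
  finally have eq: "real j * conformal_p (x, u) j = (\<Sum>i=1..T. n i) + (\<Sum>i=T+1..j. n i)" .
  have "A \<le> (\<Sum>i=1..T. n i)" "(\<Sum>i=1..T. n i) \<le> B"
    unfolding A_def B_def by (intro sum_mono n)+
  moreover have "0 \<le> (\<Sum>i=T+1..j. n i)"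
    by (intro sum_nonneg n)
  moreover have "(\<Sum>i=T+1..j. n i) \<le> (\<Sum>i=T+1..j. 1)"
    by (intro sum_mono n)
  moreover have "(\<Sum>i=T+1..j. 1 :: real) = real j - real T"
    using T by simp
  moreover have "0 \<le> (real j - real T) * F" "(real j - real T) * F \<le> real j - real T"
    using T F by (auto intro: mult_left_le)
  moreover have "real j * \<bar>conformal_p (x, u) j - F\<bar> = \<bar>real j * conformal_p (x, u) j - real j * F\<bar>"
    by (simp add: abs_mult right_diff_distrib[symmetric])
  ultimately show ?thesis
    unfolding A_def[symmetric] B_def[symmetric] eq by (simp add: algebra_simps)
qed

text \<open>The random set \<open>A (x j)\<close> depends only on \<open>x j\<close>, which is
  independent of the first \<open>T\<close> observations because \<open>T < j\<close>. Fixing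
  \<open>x j = y\<close> leaves the deviation for one fixed set, so no bound uniform over all sets
  is called for. The set-valued \<open>A\<close> covers both open and closed half-lines.\<close>

lemma nn_integral_row_law_empirical:
  assumes P: "real_distribution P0" "real_distribution P1" and T: "1 \<le> T" "T < j"
    and A: "\<And>y. A y \<in> sets borel" "\<And>y. measure P0 (A y) = cdf P0 y"
    and mA: "{z. fst z \<in> A (snd z)} \<in> sets (borel \<Otimes>\<^sub>M borel)"
  defines "g \<equiv> \<lambda>x. ennreal \<bar>(\<Sum>i=1..T. of_bool (x i \<in> A (x j))) - real T * cdf P0 (x j)\<bar>"
  shows "(\<integral>\<^sup>+\<omega>. g (fst \<omega>) \<partial>row_law P0 T P1) \<le> ennreal (sqrt (real T))"
    and "(\<lambda>\<omega>. g (fst \<omega>)) \<in> borel_measurable (row_law P0 T P1)"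
proof -
  interpret P0: real_distribution P0 by (rule P)
  interpret P1: real_distribution P1 by (rule P)
  let ?M = "\<lambda>j::nat. if j \<le> T then P0 else P1" and ?J = "insert j {1..T}"
  interpret X: product_prob_space ?M "{1..}"
    by (rule row_law_prob_spaces[OF P])
  have coord: "(\<lambda>x. x i) \<in> borel_measurable (PiM I ?M)" if "i \<in> I" for i I
    by (rule measurable_PiM_coordinate_borel[OF that]) simp
  have g: "g \<in> borel_measurable (PiM I ?M)" if I: "?J \<subseteq> I" for I
  proof -
    have [measurable]: "(\<lambda>x. x j) \<in> borel_measurable (PiM I ?M)"
      using I by (intro coord) auto
    have F [measurable]: "(\<lambda>x. cdf P0 (x j)) \<in> borel_measurable (PiM I ?M)"
      by (rule measurable_compose[OF _ P0.borel_measurable_cdf]) measurable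
    have [measurable]: "(\<lambda>x. \<Sum>i=1..T. of_bool (x i \<in> A (x j)) :: real) \<in> borel_measurable (PiM I ?M)"
    proof (rule borel_measurable_sum)
      fix i assume "i \<in> {1..T}"
      then have [measurable]: "(\<lambda>x. x i) \<in> borel_measurable (PiM I ?M)"
        using I by (intro coord) auto
      have "(\<lambda>x. (x i, x j)) \<in> PiM I ?M \<rightarrow>\<^sub>M borel \<Otimes>\<^sub>M borel"
        by measurable
      from measurable_compose[OF this borel_measurable_indicator[OF mA]]
      show "(\<lambda>x. of_bool (x i \<in> A (x j)) :: real) \<in> borel_measurable (PiM I ?M)"
        by (simp add: indicator_def of_bool_def)
    qed
    show ?thesis
      unfolding g_def by measurable
  qed
  show "(\<lambda>\<omega>. g (fst \<omega>)) \<in> borel_measurable (row_law P0 T P1)"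
    unfolding row_law_def by (rule measurable_compose[OF measurable_fst g]) (use T in auto)
  have "(\<Sum>i=1..T. of_bool (restrict x ?J i \<in> A (restrict x ?J j))) = (\<Sum>i=1..T. of_bool (x i \<in> A (x j)) :: real)" for x
    by (intro sum.cong) auto
  then have "(\<integral>\<^sup>+\<omega>. g (fst \<omega>) \<partial>row_law P0 T P1) = (\<integral>\<^sup>+\<omega>. g (restrict (fst \<omega>) ?J) \<partial>row_law P0 T P1)"
    unfolding g_def by (simp del: One_nat_def sum_of_bool_eq)
  also have "\<dots> = (\<integral>\<^sup>+x. g x \<partial>PiM ?J ?M)"
    by (rule nn_integral_row_law_fst[OF P _ _ g]) (use T in auto)
  \<comment> \<open>Again the later observation is integrated outermost, which freezes the set while
    the first \<open>T\<close> observations vary.\<close>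
  also have "\<dots> = (\<integral>\<^sup>+y. (\<integral>\<^sup>+x. g (x(j := y)) \<partial>PiM {1..T} ?M) \<partial>?M j)"
    by (rule X.product_nn_integral_insert_rev[OF _ _ g]) (use T in auto)
  also have "\<dots> \<le> (\<integral>\<^sup>+y. ennreal (sqrt (real T)) \<partial>?M j)"
  proof (rule nn_integral_mono)
    fix y
    have MT: "PiM {1..T} ?M = PiM {1..T} (\<lambda>_. P0)"
      by (rule PiM_cong) auto
    have "g (x(j := y)) = ennreal \<bar>(\<Sum>i=1..T. of_bool (x i \<in> A y)) - real T * measure P0 (A y)\<bar>" for x
    proof -
      have "(\<Sum>i=1..T. of_bool ((x(j := y)) i \<in> A y)) = (\<Sum>i=1..T. of_bool (x i \<in> A y) :: real)"
        using T by (intro sum.cong) auto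
      then show ?thesis
        by (simp add: g_def A del: sum_of_bool_eq One_nat_def)
    qed
    then show "(\<integral>\<^sup>+x. g (x(j := y)) \<partial>PiM {1..T} ?M) \<le> ennreal (sqrt (real T))"
      unfolding MT using nn_integral_empirical_measure[OF P(1) T(1) A(1), of y] by simp
  qed
  also have "\<dots> = ennreal (sqrt (real T))"
    using T P1.emeasure_space_1 by simp
  finally show "(\<integral>\<^sup>+\<omega>. g (fst \<omega>) \<partial>row_law P0 T P1) \<le> ennreal (sqrt (real T))" .
qed

text \<open>Continuity of the CDF gives the half-lines below \<open>y\<close> with and without
  \<open>y\<close> the same mass, so each of the two empirical counts deviates from
  \<open>T * cdf P0 y\<close> by at most \<open>sqrt T\<close> in mean. Dividing by
  \<open>T\<close>, although the p-value is normalized by \<open>j > T\<close>, makes the bound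
  uniform over the window.\<close>

lemma nn_integral_conformal_p_deviation:
  assumes P: "real_distribution P0" "real_distribution P1" and cont: "continuous_on UNIV (cdf P0)"
    and T: "1 \<le> T" "T < j" "j \<le> T + r"
  shows "(\<integral>\<^sup>+\<omega>. ennreal \<bar>conformal_p \<omega> j - cdf P0 (fst \<omega> j)\<bar> \<partial>row_law P0 T P1)
    \<le> ennreal ((2 * sqrt (real T) + real r) / real T)"
proof -
  interpret P0: real_distribution P0 by (rule P)
  interpret R: prob_space "row_law P0 T P1"
    by (rule row_law_prob_spaces[OF P])
  define G where "G A \<omega> = ennreal \<bar>(\<Sum>i=1..T. of_bool (fst \<omega> i \<in> A (fst \<omega> j))) - real T * cdf P0 (fst \<omega> j)\<bar>"
    for A :: "real \<Rightarrow> real set" and \<omega> :: "(nat \<Rightarrow> real) \<times> (nat \<Rightarrow> real)"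
  have "measure P0 {..<y} = cdf P0 y" for y
  proof -
    have "isCont (cdf P0) y"
      using cont by (simp add: continuous_on_eq_continuous_at)
    then have "measure P0 {y} = 0"
      by (simp add: P0.isCont_cdf)
    moreover have "measure P0 ({..<y} \<union> {y}) = measure P0 {..<y} + measure P0 {y}"
      by (intro P0.finite_measure_Union) auto
    moreover have "{..<y} \<union> {y} = {..y}"
      by auto
    ultimately show ?thesis
      by (simp add: cdf_def)
  qed
  moreover have "{z :: real \<times> real. fst z \<in> {..<snd z}} \<in> sets (borel \<Otimes>\<^sub>M borel)"
    "{z :: real \<times> real. fst z \<in> {..snd z}} \<in> sets (borel \<Otimes>\<^sub>M borel)"
    unfolding borel_prod mem_Collect_eq lessThan_iff atMost_iff
    by (intro borel_open borel_closed open_Collect_less closed_Collect_le continuous_intros)+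
  ultimately have G: "(\<integral>\<^sup>+\<omega>. G lessThan \<omega> \<partial>row_law P0 T P1) \<le> ennreal (sqrt (real T))"
      "G lessThan \<in> borel_measurable (row_law P0 T P1)"
      "(\<integral>\<^sup>+\<omega>. G atMost \<omega> \<partial>row_law P0 T P1) \<le> ennreal (sqrt (real T))"
      "G atMost \<in> borel_measurable (row_law P0 T P1)"
    using nn_integral_row_law_empirical[OF P T(1,2), of lessThan]
      nn_integral_row_law_empirical[OF P T(1,2), of atMost]
    unfolding G_def by (simp_all add: cdf_def del: One_nat_def)
  have "(\<integral>\<^sup>+\<omega>. ennreal \<bar>conformal_p \<omega> j - cdf P0 (fst \<omega> j)\<bar> \<partial>row_law P0 T P1)
      \<le> (\<integral>\<^sup>+\<omega>. ennreal (1 / real T) * (G lessThan \<omega> + G atMost \<omega> + ennreal (real r)) \<partial>row_law P0 T P1)"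
  proof (rule nn_integral_mono)
    fix \<omega> assume "\<omega> \<in> space (row_law P0 T P1)"
    then obtain x u where \<omega>: "\<omega> = (x, u)" and u: "u j \<in> {0..1}"
      using T by (cases \<omega>) (auto simp: row_law_def space_pair_measure space_PiM PiE_def Pi_def)
    let ?d = "\<bar>conformal_p (x, u) j - cdf P0 (x j)\<bar>"
    have "real T * ?d \<le> real j * ?d"
      using T by (intro mult_right_mono) auto
    also have "\<dots> \<le> \<bar>(\<Sum>i=1..T. of_bool (x i < x j)) - real T * cdf P0 (x j)\<bar>
        + \<bar>(\<Sum>i=1..T. of_bool (x i \<le> x j)) - real T * cdf P0 (x j)\<bar> + (real j - real T)"
      by (rule conformal_p_deviation) (use T u P0.cdf_bounds in auto)
    also have "real j - real T \<le> real r"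
      using T by simp
    finally have "?d \<le> 1 / real T * (\<bar>(\<Sum>i=1..T. of_bool (x i < x j)) - real T * cdf P0 (x j)\<bar>
        + \<bar>(\<Sum>i=1..T. of_bool (x i \<le> x j)) - real T * cdf P0 (x j)\<bar> + real r)"
      using T by (simp add: field_simps)
    then show "ennreal \<bar>conformal_p \<omega> j - cdf P0 (fst \<omega> j)\<bar>
        \<le> ennreal (1 / real T) * (G lessThan \<omega> + G atMost \<omega> + ennreal (real r))"
      unfolding G_def \<omega>
      by (simp add: ennreal_mult[symmetric] ennreal_plus[symmetric] ennreal_leI del: ennreal_plus One_nat_def sum_of_bool_eq)
  qed
  also have "\<dots> = ennreal (1 / real T) * ((\<integral>\<^sup>+\<omega>. G lessThan \<omega> \<partial>row_law P0 T P1)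
      + (\<integral>\<^sup>+\<omega>. G atMost \<omega> \<partial>row_law P0 T P1) + ennreal (real r))"
    using G(2,4) by (simp add: nn_integral_cmult nn_integral_add R.emeasure_space_1)
  also have "\<dots> \<le> ennreal (1 / real T) * (ennreal (sqrt (real T)) + ennreal (sqrt (real T)) + ennreal (real r))"
    by (intro mult_left_mono add_mono G order_refl) auto
  also have "\<dots> = ennreal ((2 * sqrt (real T) + real r) / real T)"
    by (simp add: ennreal_mult[symmetric] ennreal_plus[symmetric] del: ennreal_plus)
  finally show ?thesis .
qed

lemma nn_integral_row_law_post_change_sum:
  assumes P: "real_distribution P0" "real_distribution P1" and r: "0 < r"
    and g: "g \<in> borel_measurable borel" and bound: "\<And>y. \<bar>g y\<bar> \<le> C" and centred: "(\<integral>y. g y \<partial>P1) = 0"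
  shows "(\<integral>\<^sup>+\<omega>. ennreal \<bar>\<Sum>j=T+1..T+r. g (fst \<omega> j)\<bar> \<partial>row_law P0 T P1)
    \<le> ennreal (sqrt (real r) * ((C\<^sup>2 + 1) / 2))"
proof -
  interpret P1: real_distribution P1 by (rule P)
  let ?M = "\<lambda>j::nat. if j \<le> T then P0 else P1" and ?J = "{T+1..T+r}"
  interpret X: product_prob_space ?M "{1..}"
    by (rule row_law_prob_spaces[OF P])
  have m: "(\<lambda>x. ennreal \<bar>\<Sum>j\<in>?J. g (x j)\<bar>) \<in> borel_measurable (PiM ?J ?M)"
  proof -
    have "(\<lambda>x. g (x j)) \<in> borel_measurable (PiM ?J ?M)" if "j \<in> ?J" for j
      using that by (intro measurable_compose[OF _ g] measurable_PiM_coordinate_borel) auto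
    then have "(\<lambda>x. \<Sum>j\<in>?J. g (x j)) \<in> borel_measurable (PiM ?J ?M)"
      by (rule borel_measurable_sum)
    then show ?thesis
      by measurable
  qed
  have "(\<Sum>j\<in>?J. g (restrict x ?J j)) = (\<Sum>j\<in>?J. g (x j))" for x
    by (intro sum.cong) auto
  then have "(\<integral>\<^sup>+\<omega>. ennreal \<bar>\<Sum>j\<in>?J. g (fst \<omega> j)\<bar> \<partial>row_law P0 T P1)
      = (\<integral>\<^sup>+\<omega>. ennreal \<bar>\<Sum>j\<in>?J. g (restrict (fst \<omega>) ?J j)\<bar> \<partial>row_law P0 T P1)"
    by simp
  also have "\<dots> = (\<integral>\<^sup>+x. ennreal \<bar>\<Sum>j\<in>?J. g (x j)\<bar> \<partial>PiM ?J ?M)"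
    by (rule nn_integral_row_law_fst[OF P _ _ m]) auto
  also have "\<dots> \<le> ennreal (sqrt (card ?J) * ((C\<^sup>2 + 1) / 2))"
    by (rule X.nn_integral_abs_sum_PiM) (use r g bound centred in auto)
  finally show ?thesis
    by simp
qed

text \<open>The p-values after the change are compared with the i.i.d. variables \<open>F(X\<^sub>j)\<close>, where \<open>F\<close> is the
  CDF of \<open>P\<^sub>0\<close>; both errors are controlled in mean, so one application of Markov's inequality suffices.\<close>

lemma prob_post_change_sum_small:
  assumes P: "real_distribution P0" "real_distribution P1" and cont: "continuous_on UNIV (cdf P0)"
    and T: "1 \<le> T" and r: "0 < r" and \<epsilon>: "0 < \<epsilon>"
    and \<phi>: "\<phi> \<in> borel_measurable (restrict_space borel {0..1})" "L-lipschitz_on {0..1} \<phi>"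
      "\<And>x. x \<in> {0..1} \<Longrightarrow> \<bar>\<phi> x - D\<bar> \<le> C"
    and D: "(\<integral>y. \<phi> (cdf P0 y) \<partial>P1) = D"
  shows "\<P>(\<omega> in row_law P0 T P1. (\<Sum>j=T+1..T+r. \<phi> (conformal_p \<omega> j)) \<le> real r * (D - \<epsilon>))
    \<le> (L * (2 * sqrt (real T) + real r) / real T + (C\<^sup>2 + 1) / 2 / sqrt (real r)) / \<epsilon>"
proof -
  interpret P0: real_distribution P0 by (rule P)
  interpret P1: real_distribution P1 by (rule P)
  interpret R: prob_space "row_law P0 T P1"
    by (rule row_law_prob_spaces[OF P])
  let ?R = "row_law P0 T P1" and ?J = "{T+1..T+r}"
  have L: "0 \<le> L"
    using \<phi>(2) by (rule lipschitz_on_nonneg)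
  have \<phi>_unif: "\<phi> \<in> borel_measurable unif01"
    using \<phi>(1) by (simp add: measurable_cong_sets[OF sets_unif01 refl])
  have F: "cdf P0 \<in> borel \<rightarrow>\<^sub>M restrict_space borel {0..1}"
    using P0.borel_measurable_cdf P0.cdf_bounds by (intro measurable_restrict_space2) auto
  define d where "d \<omega> j = ennreal \<bar>conformal_p \<omega> j - cdf P0 (fst \<omega> j)\<bar>" for \<omega> j
  define g where "g y = \<phi> (cdf P0 y) - D" for y
  have \<phi>F: "(\<lambda>y. \<phi> (cdf P0 y)) \<in> borel_measurable borel"
    by (rule measurable_compose[OF F \<phi>(1)])
  then have g: "g \<in> borel_measurable borel"
    unfolding g_def by measurable
  have g_bound: "\<bar>g y\<bar> \<le> C" for y
    unfolding g_def by (rule \<phi>(3)[OF P0.cdf_bounds])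
  have "integrable P1 g"
    using g g_bound by (intro P1.integrable_const_bound[where B = C]) auto
  then have "integrable P1 (\<lambda>y. g y + D)"
    by simp
  then have "integrable P1 (\<lambda>y. \<phi> (cdf P0 y))"
    by (simp add: g_def)
  then have centred: "(\<integral>y. g y \<partial>P1) = 0"
    unfolding g_def using D P1.prob_space by (subst Bochner_Integration.integral_diff) auto
  have coord: "(\<lambda>\<omega>. fst \<omega> j) \<in> borel_measurable ?R" if "j \<in> ?J" for j
    unfolding row_law_def
    by (rule measurable_compose[OF measurable_fst measurable_PiM_coordinate_borel]) (use that in auto)
  have p: "(\<lambda>\<omega>. conformal_p \<omega> j) \<in> ?R \<rightarrow>\<^sub>M unif01" if "j \<in> ?J" for j
    using that by (intro measurable_conformal_p_row_law P) auto
  have d: "(\<lambda>\<omega>. d \<omega> j) \<in> borel_measurable ?R" if "j \<in> ?J" for j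
  proof -
    note [measurable] = measurable_compose[OF p[OF that] measurable_unif01_borel]
      measurable_compose[OF coord[OF that] P0.borel_measurable_cdf]
    show ?thesis
      unfolding d_def by measurable
  qed
  have s: "(\<lambda>\<omega>. ennreal \<bar>\<Sum>j\<in>?J. g (fst \<omega> j)\<bar>) \<in> borel_measurable ?R"
  proof -
    have "(\<lambda>\<omega>. g (fst \<omega> j)) \<in> borel_measurable ?R" if "j \<in> ?J" for j
      by (rule measurable_compose[OF coord[OF that] g])
    then have [measurable]: "(\<lambda>\<omega>. \<Sum>j\<in>?J. g (fst \<omega> j)) \<in> borel_measurable ?R"
      by (rule borel_measurable_sum)
    show ?thesis
      by measurable
  qed
  have Y: "(\<lambda>\<omega>. \<Sum>j\<in>?J. \<phi> (conformal_p \<omega> j)) \<in> borel_measurable ?R"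
    by (intro borel_measurable_sum measurable_compose[OF p \<phi>_unif])
  define Y where "Y \<omega> = ennreal \<bar>(\<Sum>j\<in>?J. \<phi> (conformal_p \<omega> j)) - real r * D\<bar>" for \<omega>
  have mY: "Y \<in> borel_measurable ?R"
    unfolding Y_def using Y by measurable
  \<comment> \<open>The deviation splits into the errors from replacing the p-values by
    \<open>cdf P0 (X j)\<close>, at most \<open>L\<close> times their distance, and a centred i.i.d.
    sum of the terms \<open>g (X j)\<close>.\<close>
  have "(\<integral>\<^sup>+\<omega>. Y \<omega> \<partial>?R) \<le> (\<integral>\<^sup>+\<omega>. ennreal L * (\<Sum>j\<in>?J. d \<omega> j) + ennreal \<bar>\<Sum>j\<in>?J. g (fst \<omega> j)\<bar> \<partial>?R)"
  proof (rule nn_integral_mono)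
    fix \<omega> assume \<omega>: "\<omega> \<in> space ?R"
    have "\<bar>\<phi> (conformal_p \<omega> j) - \<phi> (cdf P0 (fst \<omega> j))\<bar> \<le> L * \<bar>conformal_p \<omega> j - cdf P0 (fst \<omega> j)\<bar>" if "j \<in> ?J" for j
      using lipschitz_onD[OF \<phi>(2) _ P0.cdf_bounds, of "conformal_p \<omega> j" "fst \<omega> j"]
        measurable_space[OF p[OF that] \<omega>] by (simp add: dist_real_def)
    then have "\<bar>\<Sum>j\<in>?J. \<phi> (conformal_p \<omega> j) - \<phi> (cdf P0 (fst \<omega> j))\<bar>
        \<le> (\<Sum>j\<in>?J. L * \<bar>conformal_p \<omega> j - cdf P0 (fst \<omega> j)\<bar>)"
      by (intro order_trans[OF sum_abs] sum_mono)
    moreover have "(\<Sum>j\<in>?J. \<phi> (conformal_p \<omega> j)) - real r * D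
        = (\<Sum>j\<in>?J. \<phi> (conformal_p \<omega> j) - \<phi> (cdf P0 (fst \<omega> j))) + (\<Sum>j\<in>?J. g (fst \<omega> j))"
      by (simp add: g_def sum_subtractf)
    ultimately have "\<bar>(\<Sum>j\<in>?J. \<phi> (conformal_p \<omega> j)) - real r * D\<bar>
        \<le> L * (\<Sum>j\<in>?J. \<bar>conformal_p \<omega> j - cdf P0 (fst \<omega> j)\<bar>) + \<bar>\<Sum>j\<in>?J. g (fst \<omega> j)\<bar>"
      unfolding sum_distrib_left by linarith
    then show "Y \<omega> \<le> ennreal L * (\<Sum>j\<in>?J. d \<omega> j) + ennreal \<bar>\<Sum>j\<in>?J. g (fst \<omega> j)\<bar>"
      unfolding Y_def d_def using L
      by (simp add: sum_ennreal ennreal_mult[symmetric] ennreal_plus[symmetric] sum_nonneg ennreal_leI del: ennreal_plus)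
  qed
  also have "\<dots> = (\<integral>\<^sup>+\<omega>. ennreal L * (\<Sum>j\<in>?J. d \<omega> j) \<partial>?R) + (\<integral>\<^sup>+\<omega>. ennreal \<bar>\<Sum>j\<in>?J. g (fst \<omega> j)\<bar> \<partial>?R)"
    by (intro nn_integral_add s borel_measurable_times_ennreal borel_measurable_sum d borel_measurable_const)
  also have "(\<integral>\<^sup>+\<omega>. ennreal L * (\<Sum>j\<in>?J. d \<omega> j) \<partial>?R) = ennreal L * (\<Sum>j\<in>?J. \<integral>\<^sup>+\<omega>. d \<omega> j \<partial>?R)"
  proof -
    have "(\<integral>\<^sup>+\<omega>. (\<Sum>j\<in>?J. d \<omega> j) \<partial>?R) = (\<Sum>j\<in>?J. \<integral>\<^sup>+\<omega>. d \<omega> j \<partial>?R)"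
      by (intro nn_integral_sum d)
    moreover have "(\<lambda>\<omega>. \<Sum>j\<in>?J. d \<omega> j) \<in> borel_measurable ?R"
      by (intro borel_measurable_sum d)
    ultimately show ?thesis
      by (simp only: nn_integral_cmult)
  qed
  also have "\<dots> + (\<integral>\<^sup>+\<omega>. ennreal \<bar>\<Sum>j\<in>?J. g (fst \<omega> j)\<bar> \<partial>?R)
      \<le> ennreal L * (\<Sum>j\<in>?J. ennreal ((2 * sqrt (real T) + real r) / real T))
        + ennreal (sqrt (real r) * ((C\<^sup>2 + 1) / 2))"
    unfolding d_def using T
    by (intro add_mono mult_left_mono sum_mono nn_integral_conformal_p_deviation[OF P cont]
        nn_integral_row_law_post_change_sum[OF P r g g_bound centred]) auto
  also have "\<dots> = ennreal (L * (real r * ((2 * sqrt (real T) + real r) / real T)) + sqrt (real r) * ((C\<^sup>2 + 1) / 2))"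
    using L by (simp add: ennreal_mult[symmetric] ennreal_plus[symmetric] sum_nonneg ennreal_of_nat_eq_real_of_nat del: ennreal_plus)
  finally have EY: "(\<integral>\<^sup>+\<omega>. Y \<omega> \<partial>?R) \<le> ennreal (L * (real r * ((2 * sqrt (real T) + real r) / real T)) + sqrt (real r) * ((C\<^sup>2 + 1) / 2))"
    (is "_ \<le> ennreal ?e") .
  let ?A = "{\<omega> \<in> space ?R. (\<Sum>j\<in>?J. \<phi> (conformal_p \<omega> j)) \<le> real r * (D - \<epsilon>)}"
  \<comment> \<open>The reciprocal of the deviation level: a sum of at most
    \<open>r * (D - \<epsilon>)\<close> lies at least \<open>r * \<epsilon>\<close> away from
    \<open>r * D\<close>, and Markov's inequality is applied to \<open>?c * Y\<close>.\<close>
  let ?c = "1 / (real r * \<epsilon>)"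
  have c: "0 < ?c"
    using r \<epsilon> by simp
  have e: "0 \<le> ?e"
    using L by (intro add_nonneg_nonneg mult_nonneg_nonneg divide_nonneg_nonneg) auto
  have "emeasure ?R ?A \<le> emeasure ?R {\<omega> \<in> space ?R. 1 \<le> ennreal ?c * Y \<omega>}"
  proof (rule emeasure_mono)
    show "?A \<subseteq> {\<omega> \<in> space ?R. 1 \<le> ennreal ?c * Y \<omega>}"
    proof safe
      fix x u assume "(\<Sum>j\<in>?J. \<phi> (conformal_p (x, u) j)) \<le> real r * (D - \<epsilon>)"
      then have "real r * \<epsilon> \<le> \<bar>(\<Sum>j\<in>?J. \<phi> (conformal_p (x, u) j)) - real r * D\<bar>"
        by (simp add: algebra_simps)
      then have "1 \<le> ?c * \<bar>(\<Sum>j\<in>?J. \<phi> (conformal_p (x, u) j)) - real r * D\<bar>"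
        using r \<epsilon> by (simp add: field_simps)
      then have "ennreal 1 \<le> ennreal (?c * \<bar>(\<Sum>j\<in>?J. \<phi> (conformal_p (x, u) j)) - real r * D\<bar>)"
        by (rule ennreal_leI)
      also have "\<dots> = ennreal ?c * Y (x, u)"
        unfolding Y_def by (rule ennreal_mult) (use c in auto)
      finally show "1 \<le> ennreal ?c * Y (x, u)"
        by simp
    qed
  qed (use mY in measurable)
  also have "\<dots> \<le> ennreal ?c * (\<integral>\<^sup>+\<omega>. Y \<omega> * indicator (space ?R) \<omega> \<partial>?R)"
    using mY by (intro nn_integral_Markov_inequality) auto
  also have "(\<integral>\<^sup>+\<omega>. Y \<omega> * indicator (space ?R) \<omega> \<partial>?R) = (\<integral>\<^sup>+\<omega>. Y \<omega> \<partial>?R)"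
    by (intro nn_integral_cong) simp
  also have "ennreal ?c * \<dots> \<le> ennreal ?c * ennreal ?e"
    by (intro mult_left_mono EY) simp
  also have "\<dots> = ennreal (?c * ?e)"
    using c e by (simp only: ennreal_mult[symmetric] less_imp_le)
  also have "?c * ?e = (L * (2 * sqrt (real T) + real r) / real T + (C\<^sup>2 + 1) / 2 / sqrt (real r)) / \<epsilon>"
  proof -
    \<comment> \<open>With \<open>s\<close> the square root of the window length, the division
      cancels \<open>r\<close> in the comparison error and turns \<open>sqrt r\<close> into
      \<open>1 / sqrt r\<close> in the i.i.d. part.\<close>
    have split: "1 / (\<rho> * \<epsilon>) * (L * (\<rho> * X) + s * K) = (L * X + K / s) / \<epsilon>"
      if "\<rho> = s * s" "0 < s" for \<rho> s X K :: real
      using that \<epsilon> by (simp add: field_simps)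
    show ?thesis
      by (subst split) (use r in auto)
  qed
  finally have "emeasure ?R ?A \<le> ennreal ((L * (2 * sqrt (real T) + real r) / real T + (C\<^sup>2 + 1) / 2 / sqrt (real r)) / \<epsilon>)" .
  moreover have "0 \<le> (L * (2 * sqrt (real T) + real r) / real T + (C\<^sup>2 + 1) / 2 / sqrt (real r)) / \<epsilon>"
    using L \<epsilon> by (intro add_nonneg_nonneg mult_nonneg_nonneg divide_nonneg_nonneg) auto
  ultimately show ?thesis
    by (simp add: R.emeasure_eq_measure)
qed

subsection \<open>Stopping times and the limits\<close>

text \<open>The infimum of a nonempty set of \<open>enat\<close> is attained, and a finite bound
  rules out the empty set, whose infimum is \<infinity>.\<close>

lemma Inf_enat_le_iff:
  "Inf {enat t |t. P t} \<le> enat N \<longleftrightarrow> (\<exists>t\<le>N. P t)"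
proof
  assume le: "Inf {enat t |t. P t} \<le> enat N"
  then obtain t where "P t"
    by (auto simp: Inf_enat_def split: if_splits)
  then have "Inf {enat t |t. P t} \<in> {enat t |t. P t}"
    by (intro wellorder_InfI[of "enat t"]) auto
  then show "\<exists>t\<le>N. P t"
    using le by auto
next
  assume "\<exists>t\<le>N. P t"
  then obtain t where "t \<le> N" "P t"
    by blast
  then show "Inf {enat t |t. P t} \<le> enat N"
    by (intro Inf_lower2[of "enat t"]) auto
qed

lemma measurable_Inf_enat:
  assumes [measurable]: "\<And>t. Measurable.pred M (P t)"
  shows "(\<lambda>\<omega>. Inf {enat t |t. P t \<omega>}) \<in> M \<rightarrow>\<^sub>M count_space UNIV"
proof -
  have "Inf {enat t |t. P t \<omega>} = (if \<exists>t. P t \<omega> then enat (LEAST t. P t \<omega>) else \<infinity>)" for \<omega>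
  proof (cases "\<exists>t. P t \<omega>")
    case True
    then have "P (LEAST t. P t \<omega>) \<omega>"
      by (rule LeastI_ex)
    then show ?thesis
      using True by (auto intro!: antisym Inf_lower Inf_greatest Least_le)
  next
    case False
    then show ?thesis
      by (simp add: Inf_enat_def)
  qed
  then show ?thesis
    by simp
qed

lemma ennreal_exp_le_if_le_elog:
  assumes "ereal x \<le> elog m"
  shows "ennreal (exp x) \<le> m"
proof (cases "m = 0 \<or> m = \<infinity>")
  case True
  then show ?thesis
    using assms by (auto simp: elog_def)
next
  case False
  then have m: "0 < enn2real m" "m = ennreal (enn2real m)"
    by (auto simp: enn2real_positive_iff less_top zero_less_iff_neq_zero)
  have "x \<le> ln (enn2real m)"
    using assms False by (simp add: elog_def)
  then have "exp x \<le> enn2real m"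
    using m(1) by (simp add: ln_ge_iff)
  then show ?thesis
    by (subst m(2)) (rule ennreal_leI)
qed

context detector
begin

lemma stat_S_eq: "stat_S \<mu> f w \<omega> t = shiryaev_roberts w (conformal_p \<omega>) t"
  by (simp add: stat_S_def shiryaev_roberts_def)

lemma stat_Z_le_stat_S:
  assumes "1 \<le> t"
  shows "stat_Z \<mu> f w \<omega> t \<le> stat_S \<mu> f w \<omega> t"
  unfolding stat_Z_def stat_S_def
  using assms by (subst Max_le_iff) (auto intro!: member_le_sum)

lemma tau_S_le_tau_Z: "tau_S \<mu> f w b \<omega> \<le> tau_Z \<mu> f w b \<omega>"
  unfolding tau_S_def tau_Z_def
  by (intro Inf_superset_mono) (use stat_Z_le_stat_S order_trans in blast)

lemma measurable_tau:
  assumes P: "real_distribution P0" "real_distribution P1"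
  shows "tau_S \<mu> f w b \<in> row_law P0 T P1 \<rightarrow>\<^sub>M count_space UNIV"
    and "tau_Z \<mu> f w b \<in> row_law P0 T P1 \<rightarrow>\<^sub>M count_space UNIV"
proof -
  have p: "(\<lambda>\<omega>. conformal_p \<omega> j) \<in> row_law P0 T P1 \<rightarrow>\<^sub>M unif01" if "1 \<le> j" for j
    by (rule measurable_conformal_p_row_law[OF P that])
  have [measurable]: "(\<lambda>\<omega>. stat_S \<mu> f w \<omega> t) \<in> borel_measurable (row_law P0 T P1)" for t
    unfolding stat_S_eq by (rule borel_measurable_shiryaev_roberts) (auto intro: p)
  have "(\<lambda>\<omega>. ennreal (w k) * mixture \<mu> f (conformal_p \<omega>) k t) \<in> borel_measurable (row_law P0 T P1)" if "1 \<le> k" for k t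
    using that by (intro borel_measurable_times_ennreal borel_measurable_const borel_measurable_mixture p) auto
  then have [measurable]: "(\<lambda>\<omega>. stat_Z \<mu> f w \<omega> t) \<in> borel_measurable (row_law P0 T P1)" for t
    unfolding stat_Z_def by (intro borel_measurable_Max) auto
  show "tau_S \<mu> f w b \<in> row_law P0 T P1 \<rightarrow>\<^sub>M count_space UNIV"
    unfolding tau_S_def[abs_def] by (intro measurable_Inf_enat) measurable
  show "tau_Z \<mu> f w b \<in> row_law P0 T P1 \<rightarrow>\<^sub>M count_space UNIV"
    unfolding tau_Z_def[abs_def] by (intro measurable_Inf_enat) measurable
qed

text \<open>An alarm up to \<open>T\<close> is decided by the first \<open>T\<close> p-values alone.
  Their law is the product of uniform laws, so the crossing bound there pulls back to the row; the
  minimum with 1 in \<open>q_bound\<close> costs nothing for a probability.\<close>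

lemma prob_false_alarm_le:
  assumes P: "real_distribution P0" "real_distribution P1" and cont: "continuous_on UNIV (cdf P0)"
    and b: "0 < b" and w: "\<And>k. 1 \<le> k \<Longrightarrow> 0 \<le> w k"
  shows "\<P>(\<omega> in row_law P0 T P1. tau_S \<mu> f w b \<omega> \<le> enat T) \<le> 1 - q_bound w T b"
proof -
  interpret R: prob_space "row_law P0 T P1"
    by (rule row_law_prob_spaces[OF P])
  let ?R = "row_law P0 T P1" and ?N = "PiM {1..T} (\<lambda>_. unif01)"
  let ?p = "\<lambda>\<omega>. \<lambda>j\<in>{1..T}. conformal_p \<omega> j"
  let ?E = "{z \<in> space ?N. \<exists>s\<in>{1..T}. ennreal b \<le> shiryaev_roberts w z s}"
  let ?A = "{\<omega> \<in> space ?R. tau_S \<mu> f w b \<omega> \<le> enat T}"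
  have p: "?p \<in> ?R \<rightarrow>\<^sub>M ?N"
    by (intro measurable_restrict measurable_conformal_p_row_law P) auto
  have SR: "(\<lambda>z. shiryaev_roberts w z s) \<in> borel_measurable ?N" if "s \<in> {1..T}" for s
    by (rule borel_measurable_shiryaev_roberts) (use that in auto)
  have E: "?E \<in> sets ?N"
    by (intro sets.sets_Collect_finite_Ex borel_measurable_le SR) auto
  have "?A = ?p -` ?E \<inter> space ?R"
  proof -
    have "shiryaev_roberts w (conformal_p \<omega>) s = shiryaev_roberts w (?p \<omega>) s" if "s \<in> {1..T}" for \<omega> s
      using that by (intro shiryaev_roberts_cong) auto
    then have "tau_S \<mu> f w b \<omega> \<le> enat T \<longleftrightarrow> (\<exists>s\<in>{1..T}. ennreal b \<le> shiryaev_roberts w (?p \<omega>) s)" for \<omega>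
      unfolding tau_S_def Inf_enat_le_iff stat_S_eq by (metis atLeastAtMost_iff)
    then show ?thesis
      using measurable_space[OF p] by blast
  qed
  then have "emeasure ?R ?A = emeasure (distr ?R ?N ?p) ?E"
    using emeasure_distr[OF p E] by simp
  also have "\<dots> = emeasure ?N ?E"
    by (simp only: distr_conformal_p[OF P cont])
  finally have "ennreal b * emeasure ?R ?A \<le> (\<Sum>k=1..T. ennreal (w k))"
    using emeasure_shiryaev_roberts_crossing[of "ennreal b" T w] by simp
  also have "\<dots> = ennreal (\<Sum>k=1..T. w k)"
    using w by (intro sum_ennreal) auto
  finally have "b * measure ?R ?A \<le> (\<Sum>k=1..T. w k)"
    using b w sum_nonneg[of "{1..T}" w]
    by (simp add: R.emeasure_eq_measure ennreal_mult[symmetric] del: One_nat_def)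
  then have "measure ?R ?A \<le> (\<Sum>k=1..T. w k) / b"
    using b by (simp add: field_simps)
  then show ?thesis
    by (simp add: q_bound_def)
qed

lemma mixture_shift: "mixture \<mu> f z (T + 1) (T + r) = mixture \<mu> f (\<lambda>i. z (T + i)) 1 r"
proof -
  have "(\<Prod>j=T+1..T+r. ennreal (f \<theta> (z j))) = (\<Prod>i=1..r. ennreal (f \<theta> (z (T + i))))" for \<theta>
    using prod.shift_bounds_cl_nat_ivl[of "\<lambda>j. ennreal (f \<theta> (z j))" 1 T r] by (simp add: add.commute)
  then show ?thesis
    by (simp add: mixture_def)
qed

text \<open>The single start \<open>k = T + 1\<close> already forces the maximum over the threshold:
  its log-mixture is at least the log-likelihood of the window minus the loss \<open>e\<close>, and
  the log-threshold left after its weight is the barrier. The loss \<open>e\<close> stands for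
  \<open>a * ln r + c\<close>.\<close>

lemma tau_Z_le:
  assumes r: "1 \<le> r" and p: "\<And>j. 1 \<le> j \<Longrightarrow> conformal_p \<omega> j \<in> {0..1}"
    and mixture_bound: "\<And>z. (\<And>i. i \<in> {1..r} \<Longrightarrow> z i \<in> {0..1}) \<Longrightarrow>
      ereal ((\<Sum>i=1..r. \<phi> (z i)) - e) \<le> elog (mixture \<mu> f z 1 r)"
    and w: "0 < w (T + 1)" and b: "0 < b"
    and large: "ln (b / w (T + 1)) + e \<le> (\<Sum>j=T+1..T+r. \<phi> (conformal_p \<omega> j))"
  shows "tau_Z \<mu> f w b \<omega> \<le> enat (T + r)"
proof -
  let ?m = "mixture \<mu> f (conformal_p \<omega>) (T + 1) (T + r)"
  have "(\<Sum>j=T+1..T+r. \<phi> (conformal_p \<omega> j)) = (\<Sum>i=1..r. \<phi> (conformal_p \<omega> (T + i)))"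
    using sum.shift_bounds_cl_nat_ivl[of "\<lambda>j. \<phi> (conformal_p \<omega> j)" 1 T r] by (simp add: add.commute)
  then have "ereal (ln (b / w (T + 1))) \<le> ereal ((\<Sum>i=1..r. \<phi> (conformal_p \<omega> (T + i))) - e)"
    using large by simp
  also have "\<dots> \<le> elog ?m"
    unfolding mixture_shift using p by (intro mixture_bound) auto
  finally have "ennreal (exp (ln (b / w (T + 1)))) \<le> ?m"
    by (rule ennreal_exp_le_if_le_elog)
  then have "ennreal (w (T + 1)) * ennreal (b / w (T + 1)) \<le> ennreal (w (T + 1)) * ?m"
    using w b by (intro mult_left_mono) auto
  then have "ennreal b \<le> ennreal (w (T + 1)) * ?m"
    using w b by (simp add: ennreal_mult[symmetric])
  also have "\<dots> \<le> stat_Z \<mu> f w \<omega> (T + r)"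
    unfolding stat_Z_def using r by (intro Max_ge) auto
  finally show ?thesis
    unfolding tau_Z_def Inf_enat_le_iff using r by (intro exI[of _ "T + r"]) auto
qed

end

text \<open>Integrating \<open>h * ln h\<close> against the uniform law is integrating
  \<open>ln h\<close> against \<open>H_law\<close>, which is the image of \<open>P1\<close> under
  \<open>cdf P0\<close>. Thus the divergence is the mean of one term of the i.i.d. comparison sum;
  the base \<open>exp 1\<close> makes the logarithm natural.\<close>

lemma KL_divergence_H_law:
  assumes P: "real_distribution P0" "real_distribution P1"
    and h: "h \<in> borel_measurable (restrict_space borel {0..1})" "\<And>x. x \<in> {0..1} \<Longrightarrow> 0 < h x"
    and H: "H_law P0 P1 = density unif01 (\<lambda>x. ennreal (h x))"
  shows "KL_divergence (exp 1) unif01 (H_law P0 P1) = (\<integral>y. ln (h (cdf P0 y)) \<partial>P1)"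
proof -
  interpret U: prob_space unif01 by (rule prob_space_unif01)
  have h': "h \<in> borel_measurable unif01"
    using h(1) by (simp add: measurable_cong_sets[OF sets_unif01 refl])
  have nn: "AE x in unif01. 0 \<le> h x"
    using h(2) by (intro AE_I2) (auto intro: less_imp_le)
  have "KL_divergence (exp 1) unif01 (H_law P0 P1) = (\<integral>x. h x * log (exp 1) (h x) \<partial>unif01)"
    unfolding H using h' nn by (intro U.KL_density) auto
  also have "\<dots> = (\<integral>x. ln (h x) \<partial>H_law P0 P1)"
    unfolding H using h' nn by (subst integral_real_density) (auto simp: log_def)
  also have "\<dots> = (\<integral>y. ln (h (cdf P0 y)) \<partial>P1)"
    unfolding H_law_def using h(1)
    by (intro integral_distr cdf_measurable_unit_interval P borel_measurable_ln)
  finally show ?thesis .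
qed

section \<open>Limits for an arbitrary extended-integer-valued time\<close>

lemma sets_Collect_enat_valued:
  assumes "\<tau> \<in> M \<rightarrow>\<^sub>M count_space UNIV"
  shows "{\<omega> \<in> space M. Q (\<tau> \<omega>)} \<in> sets M"
  using measurable_sets[OF assms, of "Collect Q"] by (simp add: vimage_def Int_def conj_commute)

lemma liminf_ereal_diff_null:
  fixes q l :: "nat \<Rightarrow> real"
  assumes "l \<longlonglongrightarrow> 0"
  shows "liminf (\<lambda>n. ereal (q n - l n)) = liminf (\<lambda>n. ereal (q n))"
proof -
  have "(\<lambda>n. ereal (- l n)) \<longlonglongrightarrow> ereal (- 0)"
    by (intro tendsto_intros assms)
  then have "liminf (\<lambda>n. ereal (- l n) + ereal (q n)) = ereal (- 0) + liminf (\<lambda>n. ereal (q n))"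
    by (rule ereal_liminf_lim_add) simp
  then show ?thesis
    by (simp flip: zero_ereal_def)
qed

text \<open>Being later than \<open>T\<close> means being in the window or later than
  \<open>x\<close>, so \<open>q\<close> is at most the window probability plus a null sequence. For
  the conditional claim the numerator is at most the probability of lateness, while the denominator
  stays away from 0 once \<open>q\<close> does.\<close>

lemma detection_limits:
  fixes \<tau> :: "nat \<Rightarrow> 'a \<Rightarrow> enat" and T :: "nat \<Rightarrow> nat" and x :: "nat \<Rightarrow> ereal" and M :: "nat \<Rightarrow> 'a measure"
  assumes M: "\<And>n. prob_space (M n)" and \<tau>: "\<And>n. \<tau> n \<in> M n \<rightarrow>\<^sub>M count_space UNIV"
    and late: "(\<lambda>n. \<P>(\<omega> in M n. ereal_of_enat (\<tau> n \<omega>) > x n)) \<longlonglongrightarrow> 0"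
    and no_alarm: "\<forall>\<^sub>F n in sequentially. q n \<le> \<P>(\<omega> in M n. \<tau> n \<omega> > enat (T n))"
  shows "(\<lambda>n. \<P>(\<omega> in M n. ereal_of_enat (\<tau> n \<omega>) \<le> x n)) \<longlonglongrightarrow> 1"
    and "liminf (\<lambda>n. ereal (q n)) > 0 \<Longrightarrow>
      (\<lambda>n. cond_prob (M n) (\<lambda>\<omega>. ereal_of_enat (\<tau> n \<omega>) > x n) (\<lambda>\<omega>. \<tau> n \<omega> > enat (T n))) \<longlonglongrightarrow> 0"
    and "liminf (\<lambda>n. ereal (\<P>(\<omega> in M n. enat (T n) < \<tau> n \<omega> \<and> ereal_of_enat (\<tau> n \<omega>) \<le> x n)))
      \<ge> liminf (\<lambda>n. ereal (q n))"
proof -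
  let ?l = "\<lambda>n. \<P>(\<omega> in M n. ereal_of_enat (\<tau> n \<omega>) > x n)"
  let ?a = "\<lambda>n. \<P>(\<omega> in M n. \<tau> n \<omega> > enat (T n))"
  let ?b = "\<lambda>n. \<P>(\<omega> in M n. enat (T n) < \<tau> n \<omega> \<and> ereal_of_enat (\<tau> n \<omega>) \<le> x n)"
  have meas: "{\<omega> \<in> space (M n). Q (\<tau> n \<omega>)} \<in> sets (M n)" for n Q
    by (rule sets_Collect_enat_valued[OF \<tau>])
  have "\<P>(\<omega> in M n. ereal_of_enat (\<tau> n \<omega>) \<le> x n) = 1 - ?l n" for n
  proof -
    interpret prob_space "M n" by (rule M)
    have "\<P>(\<omega> in M n. \<not> ereal_of_enat (\<tau> n \<omega>) > x n) = 1 - ?l n"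
      by (rule prob_neg) (rule meas[of n "\<lambda>t. ereal_of_enat t > x n"])
    then show ?thesis
      by (simp add: not_less)
  qed
  then show "(\<lambda>n. \<P>(\<omega> in M n. ereal_of_enat (\<tau> n \<omega>) \<le> x n)) \<longlonglongrightarrow> 1"
    using tendsto_diff[OF tendsto_const late, of 1] by simp
  have b: "?a n \<le> ?b n + ?l n" for n
  proof -
    interpret prob_space "M n" by (rule M)
    have "?a n \<le> measure (M n) ({\<omega> \<in> space (M n). enat (T n) < \<tau> n \<omega> \<and> ereal_of_enat (\<tau> n \<omega>) \<le> x n}
        \<union> {\<omega> \<in> space (M n). ereal_of_enat (\<tau> n \<omega>) > x n})"
      by (rule finite_measure_mono) (auto intro!: sets.Un meas[of n "\<lambda>t. ereal_of_enat t > x n"]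
          meas[of n "\<lambda>t. enat (T n) < t \<and> ereal_of_enat t \<le> x n"])
    also have "\<dots> \<le> ?b n + ?l n"
      by (intro measure_Un_le meas[of n "\<lambda>t. ereal_of_enat t > x n"]
          meas[of n "\<lambda>t. enat (T n) < t \<and> ereal_of_enat t \<le> x n"])
    finally show ?thesis .
  qed
  have "liminf (\<lambda>n. ereal (q n)) = liminf (\<lambda>n. ereal (q n - ?l n))"
    by (rule liminf_ereal_diff_null[OF late, symmetric])
  also have "\<dots> \<le> liminf (\<lambda>n. ereal (?b n))"
    using no_alarm
  proof (intro Liminf_mono, eventually_elim)
    case (elim n)
    then show ?case
      using b[of n] by simp
  qed
  finally show "liminf (\<lambda>n. ereal (?b n)) \<ge> liminf (\<lambda>n. ereal (q n))" .
  assume "liminf (\<lambda>n. ereal (q n)) > 0"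
  \<comment> \<open>A real number strictly below the lower limit is an eventual lower bound for
    \<open>q n\<close>, and through \<open>no_alarm\<close> for the conditioning
    probability.\<close>
  then obtain \<delta> where \<delta>: "0 < ereal \<delta>" "ereal \<delta> < liminf (\<lambda>n. ereal (q n))"
    using ereal_dense2 by blast
  then have "\<forall>\<^sub>F n in sequentially. ereal \<delta> < ereal (q n)"
    by (intro less_LiminfD)
  then have "\<forall>\<^sub>F n in sequentially. norm (cond_prob (M n) (\<lambda>\<omega>. ereal_of_enat (\<tau> n \<omega>) > x n) (\<lambda>\<omega>. \<tau> n \<omega> > enat (T n))) \<le> ?l n / \<delta>"
    using no_alarm
  proof eventually_elim
    case (elim n)
    interpret prob_space "M n" by (rule M)
    have "\<P>(\<omega> in M n. ereal_of_enat (\<tau> n \<omega>) > x n \<and> \<tau> n \<omega> > enat (T n)) \<le> ?l n"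
      by (rule finite_measure_mono) (auto intro: meas[of n "\<lambda>t. ereal_of_enat t > x n"])
    then show ?case
      using elim \<delta>(1) unfolding cond_prob_def by (auto intro!: frac_le)
  qed
  moreover have "(\<lambda>n. ?l n / \<delta>) \<longlonglongrightarrow> 0"
    using tendsto_divide[OF late tendsto_const, of \<delta>] \<delta>(1) by simp
  ultimately show "(\<lambda>n. cond_prob (M n) (\<lambda>\<omega>. ereal_of_enat (\<tau> n \<omega>) > x n) (\<lambda>\<omega>. \<tau> n \<omega> > enat (T n))) \<longlonglongrightarrow> 0"
    by (rule Lim_null_comparison)
qed

theorem theorem3p4:
  fixes T :: "nat \<Rightarrow> nat" and P0 P1 :: "real measure"
    and \<mu> :: "'p measure" and f :: "'p \<Rightarrow> real \<Rightarrow> real"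
    and w b :: "nat \<Rightarrow> real" and h :: "real \<Rightarrow> real" and a c :: real
  assumes T_pos: "\<And>n. 1 \<le> n \<Longrightarrow> 0 < T n"
    and T_incr: "mono_on {1..} T"
    and T_lim: "filterlim T at_top sequentially"
    and P0: "real_distribution P0"
    and P1: "real_distribution P1"
    and Pi: "prob_space \<mu>"
    and f_meas: "case_prod f \<in> borel_measurable (\<mu> \<Otimes>\<^sub>M restrict_space borel {0..1})"
    and f_nonneg: "\<And>\<theta> x. \<theta> \<in> space \<mu> \<Longrightarrow> x \<in> {0..1} \<Longrightarrow> 0 \<le> f \<theta> x"
    and f_density: "\<And>\<theta>. \<theta> \<in> space \<mu> \<Longrightarrow> (\<integral>\<^sup>+x. ennreal (f \<theta> x) \<partial>unif01) = 1"
    and w_nonneg: "\<And>k. 1 \<le> k \<Longrightarrow> 0 \<le> w k"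
    and b_pos: "\<And>n. 1 \<le> n \<Longrightarrow> 0 < b n"
    and F_cont: "continuous_on UNIV (cdf P0)"
    and H_cont: "continuous_on {0..1} (H_cdf P0 P1)"
    and H_0: "H_cdf P0 P1 0 = 0"
    and separation: "(SUP t\<in>{0..1}. \<bar>H_cdf P0 P1 t - t\<bar>) > 0"
    and H_ac: "absolutely_continuous unif01 (H_law P0 P1)"
    and h_meas: "h \<in> borel_measurable (restrict_space borel {0..1})"
    and h_pos: "\<And>x. x \<in> {0..1} \<Longrightarrow> 0 < h x"
    and h_density: "H_law P0 P1 = density unif01 (\<lambda>x. ennreal (h x))"
    and KL_finite: "integrable (H_law P0 P1) (entropy_density (exp 1) unif01 (H_law P0 P1))"
    and KL_pos: "0 < KL_divergence (exp 1) unif01 (H_law P0 P1)"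
    and log_h_bounded: "bounded ((\<lambda>x. ln (h x)) ` {0..1})"
    and log_h_lipschitz: "\<exists>L. L-lipschitz_on {0..1} (\<lambda>x. ln (h x))"
    and a_nonneg: "0 \<le> a" and c_nonneg: "0 \<le> c"
    and mixture_bound: "\<And>r z. 1 \<le> r \<Longrightarrow> (\<And>i. i \<in> {1..r} \<Longrightarrow> z i \<in> {0..1}) \<Longrightarrow>
          elog (mixture \<mu> f z 1 r) \<ge> ereal ((\<Sum>i=1..r. ln (h (z i))) - a * ln (real r) - c)"
    and barrier_lim: "(\<lambda>n. barrier w (T n) (b n)) \<longlonglongrightarrow> \<infinity>"
    and barrier_small: "(\<lambda>n. barrier w (T n) (b n) / ereal (real (T n))) \<longlonglongrightarrow> 0"
  shows "\<forall>A > 1 / KL_divergence (exp 1) unif01 (H_law P0 P1). \<forall>\<tau> \<in> {tau_Z \<mu> f w, tau_S \<mu> f w}.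
    (\<lambda>n. \<P>(\<omega> in row_law P0 (T n) P1.
        ereal_of_enat (\<tau> (b n) \<omega>) \<le> ereal (real (T n)) + ereal A * barrier w (T n) (b n)))
      \<longlonglongrightarrow> 1
    \<and> (liminf (\<lambda>n. ereal (q_bound w (T n) (b n))) > 0 \<longrightarrow>
        (\<lambda>n. cond_prob (row_law P0 (T n) P1)
            (\<lambda>\<omega>. ereal_of_enat (\<tau> (b n) \<omega>) > ereal (real (T n)) + ereal A * barrier w (T n) (b n))
            (\<lambda>\<omega>. \<tau> (b n) \<omega> > enat (T n)))
          \<longlonglongrightarrow> 0
        \<and> liminf (\<lambda>n. ereal (\<P>(\<omega> in row_law P0 (T n) P1.
              enat (T n) < \<tau> (b n) \<omega> \<and>
              ereal_of_enat (\<tau> (b n) \<omega>) \<le> ereal (real (T n)) + ereal A * barrier w (T n) (b n))))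
          \<ge> liminf (\<lambda>n. ereal (q_bound w (T n) (b n))))"
proof -
  interpret P0: real_distribution P0 by fact
  interpret P1: real_distribution P1 by fact
  interpret D: detector \<mu> f
    using Pi f_meas f_density by (simp add: detector_def detector_axioms_def)
  define K where "K = KL_divergence (exp 1) unif01 (H_law P0 P1)"
  define \<phi> where "\<phi> x = ln (h x)" for x
  have K: "(\<integral>y. \<phi> (cdf P0 y) \<partial>P1) = K"
    unfolding K_def \<phi>_def by (rule KL_divergence_H_law[symmetric]) (use P0 P1 h_meas h_pos h_density in auto)
  have K_pos: "0 < K"
    using KL_pos by (simp add: K_def)
  obtain L where L: "L-lipschitz_on {0..1} \<phi>"
    using log_h_lipschitz unfolding \<phi>_def[abs_def] by blast
  have \<phi>_meas: "\<phi> \<in> borel_measurable (restrict_space borel {0..1})"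
    unfolding \<phi>_def[abs_def] using h_meas by measurable
  obtain C0 where "\<And>x. x \<in> {0..1} \<Longrightarrow> \<bar>\<phi> x\<bar> \<le> C0"
    using log_h_bounded unfolding \<phi>_def bounded_iff by force
  then have C: "\<bar>\<phi> x - K\<bar> \<le> C0 + K" if "x \<in> {0..1}" for x
    using that K_pos by (smt (verit))
  define \<beta> where "\<beta> n = ln (b n / w (T n + 1))" for n
  have T1: "\<forall>\<^sub>F n in sequentially. 1 \<le> T n"
    using T_lim by (simp add: filterlim_at_top)
  have n1: "\<forall>\<^sub>F n in sequentially. 1 \<le> n"
    by (rule eventually_ge_at_top)
  \<comment> \<open>A vanishing weight would make the barrier, and hence its ratio to
    \<open>T n\<close>, infinite. A ratio tending to 0 therefore forces positive weights eventually,
    and from then on the barrier is the real number \<open>\<beta> n\<close>.\<close>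
  have "\<forall>\<^sub>F n in sequentially. barrier w (T n) (b n) / ereal (real (T n)) < ereal 1"
    using order_tendstoD(2)[OF barrier_small, of "ereal 1"] by simp
  then have w_pos: "\<forall>\<^sub>F n in sequentially. 0 < w (T n + 1)"
    using T1 n1
  proof eventually_elim
    case (elim n)
    then have "barrier w (T n) (b n) \<noteq> \<infinity>"
      by auto
    then have "w (T n + 1) \<noteq> 0"
      using barrier_eq[of "b n" w "T n"] b_pos[of n] w_nonneg[of "T n + 1"] elim by auto
    then show ?case
      using w_nonneg[of "T n + 1"] by (simp add: less_le)
  qed
  have \<beta>: "\<forall>\<^sub>F n in sequentially. barrier w (T n) (b n) = ereal (\<beta> n)"
    using w_pos n1 by eventually_elim (use b_pos in \<open>auto simp: barrier_eq \<beta>_def\<close>)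
  have \<beta>_lim: "filterlim \<beta> at_top sequentially"
  proof -
    have "(\<lambda>n. ereal (\<beta> n)) \<longlonglongrightarrow> \<infinity>"
      by (rule Lim_transform_eventually[OF barrier_lim \<beta>])
    then show ?thesis
      by (simp add: tendsto_PInfty_eq_at_top)
  qed
  have \<beta>_small: "(\<lambda>n. \<beta> n / real (T n)) \<longlonglongrightarrow> 0"
  proof -
    have "\<forall>\<^sub>F n in sequentially. barrier w (T n) (b n) / ereal (real (T n)) = ereal (\<beta> n / real (T n))"
      using \<beta> T1 by eventually_elim simp
    from Lim_transform_eventually[OF barrier_small this] show ?thesis
      by (simp add: zero_ereal_def)
  qed
  \<comment> \<open>Both detectors are covered by the sum: \<open>tau_S > T\<close> implies
    \<open>\<tau> > T\<close> in either case, and the false-alarm bound is available for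
    \<open>tau_S\<close>.\<close>
  have no_alarm: "\<forall>\<^sub>F n in sequentially. q_bound w (T n) (b n)
      \<le> \<P>(\<omega> in row_law P0 (T n) P1. \<tau> (b n) \<omega> > enat (T n))"
    if \<tau>: "\<tau> \<in> {tau_Z \<mu> f w, tau_S \<mu> f w}" for \<tau>
    using n1
  proof eventually_elim
    case (elim n)
    interpret R: prob_space "row_law P0 (T n) P1"
      by (rule row_law_prob_spaces[OF P0 P1])
    note S = sets_Collect_enat_valued[OF D.measurable_tau(1)[OF P0 P1]]
    note Z = sets_Collect_enat_valued[OF D.measurable_tau(2)[OF P0 P1]]
    have "q_bound w (T n) (b n) \<le> 1 - \<P>(\<omega> in row_law P0 (T n) P1. tau_S \<mu> f w (b n) \<omega> \<le> enat (T n))"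
      using D.prob_false_alarm_le[where w = w and T = "T n", OF P0 P1 F_cont b_pos[OF elim]] w_nonneg
      by (simp add: algebra_simps)
    also have "\<dots> = \<P>(\<omega> in row_law P0 (T n) P1. \<not> tau_S \<mu> f w (b n) \<omega> \<le> enat (T n))"
      by (rule R.prob_neg[symmetric]) (rule S)
    also have "\<dots> \<le> \<P>(\<omega> in row_law P0 (T n) P1. \<tau> (b n) \<omega> > enat (T n))"
    proof (rule R.finite_measure_mono)
      show "{\<omega> \<in> space (row_law P0 (T n) P1). \<not> tau_S \<mu> f w (b n) \<omega> \<le> enat (T n)}
          \<subseteq> {\<omega> \<in> space (row_law P0 (T n) P1). \<tau> (b n) \<omega> > enat (T n)}"
        using \<tau> D.tau_S_le_tau_Z less_le_trans by (auto simp: not_le) blast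
      show "{\<omega> \<in> space (row_law P0 (T n) P1). \<tau> (b n) \<omega> > enat (T n)} \<in> sets (row_law P0 (T n) P1)"
        using \<tau> S[where Q = "\<lambda>t. t > enat (T n)"] Z[where Q = "\<lambda>t. t > enat (T n)"] by auto
    qed
    finally show ?case .
  qed
  have late: "(\<lambda>n. \<P>(\<omega> in row_law P0 (T n) P1.
      ereal_of_enat (\<tau> (b n) \<omega>) > ereal (real (T n)) + ereal A * barrier w (T n) (b n))) \<longlonglongrightarrow> 0"
    if A: "1 / K < A" and \<tau>: "\<tau> \<in> {tau_Z \<mu> f w, tau_S \<mu> f w}" for A \<tau>
  proof -
    have A_pos: "0 < A"
      using A K_pos by (intro less_trans[of 0 "1 / K" A]) auto
    then have A_inv: "1 / A < K"
      using A K_pos by (simp add: field_simps)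
    \<comment> \<open>Half the gap between \<open>K\<close> and \<open>1 / A\<close>. One half is
      given up in the law of large numbers; the other remains as a surplus of
      \<open>\<epsilon>\<close> per observation over \<open>1 / A\<close>.\<close>
    define \<epsilon> where "\<epsilon> = (K - 1 / A) / 2"
    have \<epsilon>: "0 < \<epsilon>" "K - \<epsilon> = 1 / A + \<epsilon>"
      using A_inv by (simp_all add: \<epsilon>_def field_simps)
    \<comment> \<open>Rounding down keeps \<open>T + r\<close> within the deadline
      \<open>T + A * \<beta>\<close> whenever \<open>\<beta>\<close> is nonnegative, as it
      eventually is.\<close>
    define r where "r n = nat \<lfloor>A * \<beta> n\<rfloor>" for n
    define bnd where "bnd n = (L * (2 * sqrt (real (T n)) + real (r n)) / real (T n)
        + ((C0 + K)\<^sup>2 + 1) / 2 / sqrt (real (r n))) / \<epsilon>" for n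
    have A\<beta>: "filterlim (\<lambda>n. A * \<beta> n) at_top sequentially"
      by (rule filterlim_tendsto_pos_mult_at_top[OF tendsto_const A_pos \<beta>_lim])
    have r_lim: "filterlim r at_top sequentially"
      unfolding r_def
      by (rule filterlim_compose[OF filterlim_nat_sequentially filterlim_compose[OF filterlim_floor_sequentially A\<beta>]])
    have r_le: "\<forall>\<^sub>F n in sequentially. real (r n) \<le> A * \<beta> n \<and> A * \<beta> n \<le> real (r n) + 1 \<and> 1 \<le> r n"
    proof -
      have "\<forall>\<^sub>F n in sequentially. 1 \<le> A * \<beta> n"
        using A\<beta> by (simp add: filterlim_at_top)
      then show ?thesis
      proof eventually_elim
        case (elim n)
        then have "real (r n) = of_int \<lfloor>A * \<beta> n\<rfloor>"
          by (simp add: r_def)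
        moreover have "1 \<le> r n"
          using elim unfolding r_def by (intro le_nat_floor) simp
        ultimately show ?case
          using floor_correct[of "A * \<beta> n"] by simp
      qed
    qed
    \<comment> \<open>Here \<open>barrier = o(T)\<close> enters: the window becomes negligible
      against the \<open>T\<close> observations before it, which makes its contamination of the
      empirical CDF vanish.\<close>
    have r_small: "(\<lambda>n. real (r n) / real (T n)) \<longlonglongrightarrow> 0"
    proof (rule tendsto_sandwich[where f = "\<lambda>_. 0" and h = "\<lambda>n. A * (\<beta> n / real (T n))"])
      show "(\<lambda>n. A * (\<beta> n / real (T n))) \<longlonglongrightarrow> 0"
        using tendsto_mult_left[OF \<beta>_small, of A] by simp
      show "\<forall>\<^sub>F n in sequentially. real (r n) / real (T n) \<le> A * (\<beta> n / real (T n))"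
        using r_le T1 by eventually_elim (simp add: divide_right_mono)
    qed auto
    have bnd: "bnd \<longlonglongrightarrow> 0"
    proof -
      have sqrt_inv: "(\<lambda>n. 1 / sqrt (real (g n))) \<longlonglongrightarrow> 0" if "filterlim g at_top sequentially" for g :: "nat \<Rightarrow> nat"
        by (intro tendsto_divide_0[OF tendsto_const] filterlim_at_top_imp_at_infinity
            filterlim_compose[OF sqrt_at_top] filterlim_compose[OF filterlim_real_sequentially that])
      have "(\<lambda>n. (L * (2 * (1 / sqrt (real (T n))) + real (r n) / real (T n))
          + ((C0 + K)\<^sup>2 + 1) / 2 * (1 / sqrt (real (r n)))) / \<epsilon>)
        \<longlonglongrightarrow> (L * (2 * 0 + 0) + ((C0 + K)\<^sup>2 + 1) / 2 * 0) / \<epsilon>"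
        using \<epsilon> by (intro tendsto_intros sqrt_inv T_lim r_lim r_small) auto
      moreover have "\<forall>\<^sub>F n in sequentially. (L * (2 * (1 / sqrt (real (T n))) + real (r n) / real (T n))
          + ((C0 + K)\<^sup>2 + 1) / 2 * (1 / sqrt (real (r n)))) / \<epsilon> = bnd n"
        using T1
      proof eventually_elim
        case (elim n)
        then have "sqrt (real (T n)) / real (T n) = 1 / sqrt (real (T n))"
          by (simp add: real_div_sqrt field_simps)
        then have "(2 * sqrt (real (T n)) + real (r n)) / real (T n) = 2 * (1 / sqrt (real (T n))) + real (r n) / real (T n)"
          by (simp add: add_divide_distrib)
        then show ?case
          unfolding bnd_def times_divide_eq_right[symmetric] by simp
      qed
      ultimately show ?thesis
        using Lim_transform_eventually by fastforce
    qed
    \<comment> \<open>Since \<open>K - \<epsilon> = 1 / A + \<epsilon>\<close>, the right side is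
      \<open>r / A + r * \<epsilon>\<close>. The first part is at least
      \<open>\<beta> - 1 / A\<close>, the defect coming from the floor; the second eventually
      exceeds \<open>a * ln r + c + 1 / A\<close>, because \<open>ln r / r\<close> and
      \<open>1 / r\<close> tend to 0.\<close>
    have large: "\<forall>\<^sub>F n in sequentially. \<beta> n + (a * ln (real (r n)) + c) \<le> real (r n) * (K - \<epsilon>)"
    proof -
      have "(\<lambda>m. a * (ln (real m) / real m) + (c + 1 / A) * (1 / real m)) \<longlonglongrightarrow> a * 0 + (c + 1 / A) * 0"
        by (intro tendsto_intros lim_ln_over_n lim_1_over_n)
      then have "\<forall>\<^sub>F m in sequentially. a * (ln (real m) / real m) + (c + 1 / A) * (1 / real m) < \<epsilon>"
        using \<epsilon>(1) by (intro order_tendstoD) auto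
      from eventually_compose_filterlim[OF this r_lim] show ?thesis
        using r_le
      proof eventually_elim
        case (elim n)
        have "(a * (l / \<rho>) + k * (1 / \<rho>)) * \<rho> = a * l + k" if "\<rho> \<noteq> 0" for l k \<rho> :: real
          using that by (simp add: distrib_right)
        note eq = this[of "real (r n)" "ln (real (r n))" "c + 1 / A"]
        have "(a * (ln (real (r n)) / real (r n)) + (c + 1 / A) * (1 / real (r n))) * real (r n) \<le> \<epsilon> * real (r n)"
          using elim by (intro mult_right_mono) auto
        then have "a * ln (real (r n)) + (c + 1 / A) \<le> \<epsilon> * real (r n)"
          by (subst (asm) eq) (use elim in auto)
        moreover have "\<beta> n \<le> real (r n) * (1 / A) + 1 / A"
          using elim A_pos by (simp add: field_simps)
        ultimately show ?case
          unfolding \<epsilon>(2) by (simp add: algebra_simps)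
      qed
    qed
    have "\<forall>\<^sub>F n in sequentially. norm (\<P>(\<omega> in row_law P0 (T n) P1.
      ereal_of_enat (\<tau> (b n) \<omega>) > ereal (real (T n)) + ereal A * barrier w (T n) (b n))) \<le> bnd n"
      using large r_le \<beta> w_pos n1 T1
    proof eventually_elim
      case (elim n)
      interpret R: prob_space "row_law P0 (T n) P1"
        by (rule row_law_prob_spaces[OF P0 P1])
      let ?s = "\<lambda>\<omega>. \<Sum>j=T n+1..T n+r n. \<phi> (conformal_p \<omega> j)"
      \<comment> \<open>A deterministic statement about one sample point: a large log-likelihood
        over the window forces a crossing by its end. Randomness is left only in the event that the
        sum is small, which \<open>bnd\<close> controls.\<close>
      have "tau_Z \<mu> f w (b n) \<omega> \<le> enat (T n + r n)"
        if \<omega>: "\<omega> \<in> space (row_law P0 (T n) P1)" and s: "real (r n) * (K - \<epsilon>) < ?s \<omega>" for \<omega>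
      proof (rule D.tau_Z_le)
        show "conformal_p \<omega> j \<in> {0..1}" if "1 \<le> j" for j
          using measurable_space[OF measurable_conformal_p_row_law[OF P0 P1 that] \<omega>] by simp
        show "ereal ((\<Sum>i=1..r n. \<phi> (z i)) - (a * ln (real (r n)) + c)) \<le> elog (mixture \<mu> f z 1 (r n))"
          if "\<And>i. i \<in> {1..r n} \<Longrightarrow> z i \<in> {0..1}" for z
          using mixture_bound[of "r n" z] that elim by (simp add: \<phi>_def algebra_simps)
        show "ln (b n / w (T n + 1)) + (a * ln (real (r n)) + c) \<le> ?s \<omega>"
          using elim s by (simp add: \<beta>_def)
      qed (use elim b_pos in auto)
      moreover have "\<tau> (b n) \<omega> \<le> tau_Z \<mu> f w (b n) \<omega>" for \<omega>
        using \<tau> by (auto intro: D.tau_S_le_tau_Z)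
      ultimately have early: "\<tau> (b n) \<omega> \<le> enat (T n + r n)"
        if "\<omega> \<in> space (row_law P0 (T n) P1)" "real (r n) * (K - \<epsilon>) < ?s \<omega>" for \<omega>
        using that order_trans by blast
      have early': "ereal_of_enat (\<tau> (b n) \<omega>) \<le> ereal (real (T n)) + ereal A * barrier w (T n) (b n)"
        if "\<omega> \<in> space (row_law P0 (T n) P1)" "real (r n) * (K - \<epsilon>) < ?s \<omega>" for \<omega>
      proof -
        have "ereal_of_enat (\<tau> (b n) \<omega>) \<le> ereal_of_enat (enat (T n + r n))"
          by (rule ereal_of_enat_le_iff[THEN iffD2, OF early[OF that]])
        also have "\<dots> \<le> ereal (real (T n)) + ereal A * barrier w (T n) (b n)"
          using elim by simp
        finally show ?thesis .
      qed
      have "\<P>(\<omega> in row_law P0 (T n) P1.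
          ereal_of_enat (\<tau> (b n) \<omega>) > ereal (real (T n)) + ereal A * barrier w (T n) (b n))
        \<le> \<P>(\<omega> in row_law P0 (T n) P1. ?s \<omega> \<le> real (r n) * (K - \<epsilon>))"
      \<comment> \<open>Contraposition of \<open>early'\<close>: a time past the deadline is
        possible only where the log-likelihood of the window falls short.\<close>
      proof (rule R.finite_measure_mono)
        show "{\<omega> \<in> space (row_law P0 (T n) P1). ereal_of_enat (\<tau> (b n) \<omega>) > ereal (real (T n)) + ereal A * barrier w (T n) (b n)}
          \<subseteq> {\<omega> \<in> space (row_law P0 (T n) P1). ?s \<omega> \<le> real (r n) * (K - \<epsilon>)}"
          using early' by (auto simp: not_le[symmetric])
        have "(\<lambda>\<omega>. \<phi> (conformal_p \<omega> j)) \<in> borel_measurable (row_law P0 (T n) P1)" if "j \<in> {T n+1..T n+r n}" for j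
          using measurable_conformal_p_row_law[OF P0 P1, of j] \<phi>_meas that
          by (intro measurable_compose[OF _ \<phi>_meas]) (auto simp: measurable_cong_sets[OF refl sets_unif01])
        then have "?s \<in> borel_measurable (row_law P0 (T n) P1)"
          by (rule borel_measurable_sum)
        then show "{\<omega> \<in> space (row_law P0 (T n) P1). ?s \<omega> \<le> real (r n) * (K - \<epsilon>)} \<in> sets (row_law P0 (T n) P1)"
          by (rule borel_measurable_le) simp
      qed
      also have "\<dots> \<le> bnd n"
        unfolding bnd_def
        by (rule prob_post_change_sum_small[OF P0 P1 F_cont _ _ \<epsilon>(1) \<phi>_meas L C K]) (use elim in auto)
      finally show ?case
        by simp
    qed
    then show ?thesis
      using bnd by (rule Lim_null_comparison)
  qed
  show ?thesis
  proof (intro allI impI ballI)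
    fix A \<tau> assume A: "1 / KL_divergence (exp 1) unif01 (H_law P0 P1) < A" and \<tau>: "\<tau> \<in> {tau_Z \<mu> f w, tau_S \<mu> f w}"
    have meas: "\<tau> (b n) \<in> row_law P0 (T n) P1 \<rightarrow>\<^sub>M count_space UNIV" for n
      using \<tau> D.measurable_tau[OF P0 P1] by auto
    note lims = detection_limits[where M = "\<lambda>n. row_law P0 (T n) P1" and \<tau> = "\<lambda>n. \<tau> (b n)",
      OF row_law_prob_spaces(4)[OF P0 P1] meas late[OF A[folded K_def] \<tau>] no_alarm[OF \<tau>]]
    show "(\<lambda>n. \<P>(\<omega> in row_law P0 (T n) P1.
        ereal_of_enat (\<tau> (b n) \<omega>) \<le> ereal (real (T n)) + ereal A * barrier w (T n) (b n)))
      \<longlonglongrightarrow> 1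
    \<and> (liminf (\<lambda>n. ereal (q_bound w (T n) (b n))) > 0 \<longrightarrow>
        (\<lambda>n. cond_prob (row_law P0 (T n) P1)
            (\<lambda>\<omega>. ereal_of_enat (\<tau> (b n) \<omega>) > ereal (real (T n)) + ereal A * barrier w (T n) (b n))
            (\<lambda>\<omega>. \<tau> (b n) \<omega> > enat (T n)))
          \<longlonglongrightarrow> 0
        \<and> liminf (\<lambda>n. ereal (\<P>(\<omega> in row_law P0 (T n) P1.
              enat (T n) < \<tau> (b n) \<omega> \<and>
              ereal_of_enat (\<tau> (b n) \<omega>) \<le> ereal (real (T n)) + ereal A * barrier w (T n) (b n))))
          \<ge> liminf (\<lambda>n. ereal (q_bound w (T n) (b n))))"
      using lims by blast
  qed
qed

end
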